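(* Suppose $N$ is a nilpotent $n\times n$ real matrix and $\mathcal C$ is a conjugacy class of nilpotent $n\times n$ real matrices, such that the following hold: (1) The Jordan form of a matrix in $\mathcal C$ has a zero block. (2) $h(\mathcal C)\ge h(N)$. (3) $\beta^{\mathrm{top}}(\mathcal C)\ge\beta(N)$. Then $\mathcal C$ is locally connected at $N$.
   Context: Conjugacy is over $\mathbb R$. A zero block is a $1\times1$ zero Jordan block. For a nilpotent matrix $M$ in Jordan form: $h(M)$ is the maximum size of a Jordan block summand of $M$; $\beta(M)$ is the number of Jordan block summands of $M$ of size at least $2\times2$; $\beta^{\mathrm{top}}(M)$ is the number of Jordan block summands of $M$ of size $h(M)\times h(M)$. For $N$ nilpotent in a conjugacy class $\mathcal C$, $h(N)=h(\mathcal C)$ is $h(M)$ for any $M$ in Jordan form conjugate to $N$, and similarly for $\beta$ and $\beta^{\mathrm{top}}$. For $\epsilon>0$, $\mathcal N_\epsilon(N)$ is the set of $n\times n$ real matrices $B$ with $\|B-N\|_{\max}<\epsilon$, where $\|\cdot\|_{\max}$ is the maximum absolute value of an entry. A conjugacy class $\mathcal C$ of $n\times n$ nilpotent matrices is locally connected at $N$ if for every $\epsilon>0$ there exists $\delta>0$ such that any two matrices in $\mathcal C\cap\mathcal N_\delta(N)$ are connected by a path in $\mathcal C\cap\mathcal N_\epsilon(N)$. *)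

theory Defs
  imports
    "HOL-Analysis.Abstract_Metric_Spaces"
    "Jordan_Normal_Form.Jordan_Normal_Form_Existence"
    "Jordan_Normal_Form.Jordan_Normal_Form_Uniqueness"
begin

definition nilpotent_mat :: "real mat \<Rightarrow> bool" where
  "nilpotent_mat A \<longleftrightarrow> square_mat A \<and> (\<exists>k. A ^\<^sub>m k = 0\<^sub>m (dim_row A) (dim_row A))"

definition conj_class :: "real mat \<Rightarrow> real mat set" where
  "conj_class A = {B. similar_mat B A}"

definition nilpotent_class :: "nat \<Rightarrow> real mat set \<Rightarrow> bool" where
  "nilpotent_class n \<C> \<longleftrightarrow> (\<exists>A \<in> carrier_mat n n. nilpotent_mat A \<and> \<C> = conj_class A)"

text \<open>
  A matrix in Jordan form is given by its list of blocks (size, eigenvalue). For a nilpotent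
  matrix every eigenvalue is 0, so only the sizes matter.
\<close>

definition blocks_h :: "(nat \<times> real) list \<Rightarrow> nat" where
  "blocks_h bs = Max (fst ` set bs)"

definition blocks_beta :: "(nat \<times> real) list \<Rightarrow> nat" where
  "blocks_beta bs = length (filter (\<lambda>(k, _). k \<ge> 2) bs)"

definition blocks_beta_top :: "(nat \<times> real) list \<Rightarrow> nat" where
  "blocks_beta_top bs = length (filter (\<lambda>(k, _). k = blocks_h bs) bs)"

definition blocks_zero_block :: "(nat \<times> real) list \<Rightarrow> bool" where
  "blocks_zero_block bs \<longleftrightarrow> (1, 0) \<in> set bs"

text \<open>
  Jordan forms are unique only up to the order of the blocks, so the choice below is a choice
  of that order; \<open>jordan_blocks_eqI\<close> shows that it does not affect the invariants, and
  \<open>nilpotent_mat_has_jordan_nf\<close> that there is something to choose from.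
\<close>

definition class_blocks :: "real mat set \<Rightarrow> (nat \<times> real) list" where
  "class_blocks \<C> = (SOME bs. \<exists>A \<in> \<C>. jordan_nf A bs)"

definition h_class :: "real mat set \<Rightarrow> nat" where
  "h_class \<C> = blocks_h (class_blocks \<C>)"

definition beta_class :: "real mat set \<Rightarrow> nat" where
  "beta_class \<C> = blocks_beta (class_blocks \<C>)"

definition beta_top_class :: "real mat set \<Rightarrow> nat" where
  "beta_top_class \<C> = blocks_beta_top (class_blocks \<C>)"

definition has_zero_block_class :: "real mat set \<Rightarrow> bool" where
  "has_zero_block_class \<C> \<longleftrightarrow> blocks_zero_block (class_blocks \<C>)"

definition h_mat :: "real mat \<Rightarrow> nat" where
  "h_mat N = h_class (conj_class N)"

definition beta_mat :: "real mat \<Rightarrow> nat" where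
  "beta_mat N = beta_class (conj_class N)"

text \<open>The element 0 is inserted only to cover the matrix without entries.\<close>

definition max_norm :: "real mat \<Rightarrow> real" where
  "max_norm A = Max (insert 0 (abs ` elements_mat A))"

text \<open>
  Off the carrier the distance is irrelevant; it is 0 there because \<open>Metric_space\<close> asks for
  symmetry on the whole type.
\<close>

definition mat_dist :: "nat \<Rightarrow> real mat \<Rightarrow> real mat \<Rightarrow> real" where
  "mat_dist n A B =
     (if A \<in> carrier_mat n n \<and> B \<in> carrier_mat n n then max_norm (A - B) else 0)"

definition mat_topology :: "nat \<Rightarrow> real mat topology" where
  "mat_topology n = Metric_space.mtopology (carrier_mat n n) (mat_dist n)"

definition mat_nbhd :: "nat \<Rightarrow> real \<Rightarrow> real mat \<Rightarrow> real mat set" where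
  "mat_nbhd n \<epsilon> N = {B \<in> carrier_mat n n. max_norm (B - N) < \<epsilon>}"

text \<open>The matrix \<open>N\<close> is not required to lie in the class, nor in its closure.\<close>

definition class_locally_connected_at :: "nat \<Rightarrow> real mat set \<Rightarrow> real mat \<Rightarrow> bool" where
  "class_locally_connected_at n \<C> N \<longleftrightarrow>
     (\<forall>\<epsilon>>0. \<exists>\<delta>>0. \<forall>A \<in> \<C> \<inter> mat_nbhd n \<delta> N. \<forall>B \<in> \<C> \<inter> mat_nbhd n \<delta> N.
        path_component_of (subtopology (mat_topology n) (\<C> \<inter> mat_nbhd n \<epsilon> N)) A B)"


lemma finite_elements_mat: "finite (elements_mat A)"
  by (simp add: elements_mat_def)

lemma max_norm_less_iff:
  assumes "A \<in> carrier_mat n n"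
  shows "max_norm A < e \<longleftrightarrow> 0 < e \<and> (\<forall>i<n. \<forall>j<n. \<bar>A $$ (i, j)\<bar> < e)"
  using assms unfolding max_norm_def
  by (subst Max_less_iff) (auto simp: finite_elements_mat elements_mat_def)

lemma max_norm_le_iff:
  assumes "A \<in> carrier_mat n n"
  shows "max_norm A \<le> e \<longleftrightarrow> 0 \<le> e \<and> (\<forall>i<n. \<forall>j<n. \<bar>A $$ (i, j)\<bar> \<le> e)"
  using assms unfolding max_norm_def
  by (subst Max_le_iff) (auto simp: finite_elements_mat elements_mat_def)

lemma Metric_space_mat: "Metric_space (carrier_mat n n) (mat_dist n)"
proof
  have nn: "0 \<le> max_norm A" for A
    by (simp add: max_norm_def finite_elements_mat)
  show nonneg: "0 \<le> mat_dist n A B" for A B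
    by (simp add: mat_dist_def nn)
  have le: "mat_dist n A B \<le> e \<longleftrightarrow> 0 \<le> e \<and> (\<forall>i<n. \<forall>j<n. \<bar>A $$ (i, j) - B $$ (i, j)\<bar> \<le> e)"
    if "A \<in> carrier_mat n n" "B \<in> carrier_mat n n" for A B e
    using that by (auto simp: mat_dist_def max_norm_le_iff[OF minus_carrier_mat])
  have comm: "mat_dist n A B \<le> mat_dist n B A" for A B
  proof (cases "A \<in> carrier_mat n n \<and> B \<in> carrier_mat n n")
    case True
    then show ?thesis
      using le[of B A "mat_dist n B A"] by (simp add: le abs_minus_commute)
  qed (auto simp: mat_dist_def)
  show "mat_dist n A B = mat_dist n B A" for A B
    using comm[of A B] comm[of B A] by simp
  show "mat_dist n A B = 0 \<longleftrightarrow> A = B" if "A \<in> carrier_mat n n" "B \<in> carrier_mat n n" for A B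
  proof -
    have "mat_dist n A B = 0 \<longleftrightarrow> mat_dist n A B \<le> 0"
      using nonneg[of A B] by linarith
    also have "\<dots> \<longleftrightarrow> A = B"
      unfolding le[OF that] using that by (auto intro!: eq_matI)
    finally show ?thesis .
  qed
  show "mat_dist n A C \<le> mat_dist n A B + mat_dist n B C"
    if "A \<in> carrier_mat n n" "B \<in> carrier_mat n n" "C \<in> carrier_mat n n" for A B C
  proof -
    have ab: "0 \<le> mat_dist n A B \<and> (\<forall>i<n. \<forall>j<n. \<bar>A $$ (i, j) - B $$ (i, j)\<bar> \<le> mat_dist n A B)"
      using le[of A B "mat_dist n A B"] that by simp
    have bc: "0 \<le> mat_dist n B C \<and> (\<forall>i<n. \<forall>j<n. \<bar>B $$ (i, j) - C $$ (i, j)\<bar> \<le> mat_dist n B C)"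
      using le[of B C "mat_dist n B C"] that by simp
    show ?thesis
      unfolding le[OF that(1,3)]
    proof (intro conjI allI impI)
      fix i j assume "i < n" "j < n"
      then have "\<bar>A $$ (i, j) - B $$ (i, j)\<bar> \<le> mat_dist n A B"
        "\<bar>B $$ (i, j) - C $$ (i, j)\<bar> \<le> mat_dist n B C"
        using ab bc by auto
      then show "\<bar>A $$ (i, j) - C $$ (i, j)\<bar> \<le> mat_dist n A B + mat_dist n B C"
        by linarith
    qed (use ab bc in simp)
  qed
qed

lemma topspace_mat_topology [simp]: "topspace (mat_topology n) = carrier_mat n n"
  by (simp add: mat_topology_def Metric_space.topspace_mtopology[OF Metric_space_mat])

lemma jordan_blocks_mset:
  fixes A :: "real mat"
  assumes "jordan_nf A bs" "jordan_nf A cs"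
  shows "mset bs = mset cs"
proof (rule multiset_eqI)
  fix x :: "nat \<times> real"
  obtain k a where x: "x = (k, a)" by force
  show "count (mset bs) x = count (mset cs) x"
  proof (cases "k = 0")
    case True
    then have "x \<notin> set bs" "x \<notin> set cs"
      using assms x unfolding jordan_nf_def by force+
    then show ?thesis
      by (metis set_mset_mset not_in_iff)
  next
    case False
    have "length (filter ((=) x) bs) = length (filter ((=) x) cs)"
      using compute_nr_of_jordan_blocks[OF assms(1) False, of a]
        compute_nr_of_jordan_blocks[OF assms(2) False, of a] x by simp
    then show ?thesis
      by (simp only: count_mset count_list_eq_length_filter)
  qed
qed

lemma jordan_blocks_eqI:
  assumes "mset bs = mset cs"
  shows "blocks_h bs = blocks_h cs" "blocks_beta bs = blocks_beta cs"
    "blocks_beta_top bs = blocks_beta_top cs" "blocks_zero_block bs = blocks_zero_block cs"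
proof -
  have s: "set bs = set cs"
    using assms by (rule mset_eq_setD)
  have f: "length (filter P bs) = length (filter P cs)" for P
    using assms by (metis mset_filter size_mset)
  show "blocks_h bs = blocks_h cs" by (simp add: blocks_h_def s)
  then show "blocks_beta_top bs = blocks_beta_top cs" by (simp add: blocks_beta_top_def f)
  show "blocks_beta bs = blocks_beta cs" by (simp add: blocks_beta_def f)
  show "blocks_zero_block bs = blocks_zero_block cs" by (simp add: blocks_zero_block_def s)
qed

lemma class_blocks_mset:
  assumes "B \<in> conj_class A" "jordan_nf B bs"
  shows "mset (class_blocks (conj_class A)) = mset bs"
proof -
  have "\<exists>cs. \<exists>C \<in> conj_class A. jordan_nf C cs"
    using assms by blast
  then obtain C where C: "C \<in> conj_class A" "jordan_nf C (class_blocks (conj_class A))"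
    unfolding class_blocks_def using someI_ex[of "\<lambda>cs. \<exists>C \<in> conj_class A. jordan_nf C cs"] by blast
  then have "similar_mat B C"
    using assms(1) similar_mat_sym similar_mat_trans unfolding conj_class_def by blast
  then have "jordan_nf B (class_blocks (conj_class A))"
    using C(2) similar_mat_trans unfolding jordan_nf_def by blast
  then show ?thesis
    using assms(2) jordan_blocks_mset by blast
qed

lemma nilpotent_mat_eigenvalue_complex:
  assumes A: "A \<in> carrier_mat n n" and nil: "A ^\<^sub>m k = 0\<^sub>m n n"
    and ev: "eigenvalue (map_mat complex_of_real A) a"
  shows "a = 0"
proof -
  let ?A = "map_mat complex_of_real A"
  have cA: "?A \<in> carrier_mat n n" using A by simp
  obtain v where v: "eigenvector ?A v a" using ev unfolding eigenvalue_def by blast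
  have "?A ^\<^sub>m k *\<^sub>v v = a ^ k \<cdot>\<^sub>v v" by (rule eigenvector_pow[OF cA v])
  moreover have "?A ^\<^sub>m k = 0\<^sub>m n n"
  proof -
    have "map_mat complex_of_real (A ^\<^sub>m k) = ?A ^\<^sub>m k"
      by (rule of_real_hom.mat_hom_pow[OF A])
    then have "?A ^\<^sub>m k = map_mat complex_of_real (0\<^sub>m n n)"
      using nil by simp
    also have "\<dots> = 0\<^sub>m n n" by (intro eq_matI) auto
    finally show ?thesis .
  qed
  moreover have vc: "v \<in> carrier_vec n" and v0: "v \<noteq> 0\<^sub>v n"
    using v cA unfolding eigenvector_def by auto
  moreover have "0\<^sub>m n n *\<^sub>v v = 0\<^sub>v n"
    using vc by (intro eq_vecI) auto
  ultimately have eq: "0\<^sub>v n = a ^ k \<cdot>\<^sub>v v" by simp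
  obtain i where i: "i < n" "v $ i \<noteq> 0"
    using vc v0 by (metis carrier_vecD eq_vecI index_zero_vec(1) index_zero_vec(2))
  have "0 = a ^ k * v $ i"
    using arg_cong[OF eq, of "\<lambda>w. w $ i"] i vc by simp
  then show ?thesis using i by simp
qed

lemma nilpotent_mat_has_jordan_nf:
  assumes A: "A \<in> carrier_mat n n" and nil: "nilpotent_mat A"
  shows "\<exists>bs. jordan_nf A bs"
proof -
  let ?A = "map_mat complex_of_real A"
  obtain k where k: "A ^\<^sub>m k = 0\<^sub>m n n" using nil A unfolding nilpotent_mat_def by auto
  have cA: "?A \<in> carrier_mat n n" using A by simp
  obtain as where as: "char_poly ?A = (\<Prod>a\<leftarrow>as. [:- a, 1:])" "length as = n"
    using char_poly_factorized[OF cA] by blast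
  have "a = 0" if "a \<in> set as" for a
  proof -
    have "poly (char_poly ?A) a = 0"
      unfolding as(1) using that by (induction as) auto
    then show ?thesis
      using nilpotent_mat_eigenvalue_complex[OF A k] eigenvalue_root_char_poly[OF cA] by blast
  qed
  then have "as = replicate n 0" using as(2) by (metis replicate_eqI)
  then have "char_poly ?A = map_poly complex_of_real (monom 1 n)"
    using as(1) by (simp add: map_poly_monom) (simp add: monom_altdef)
  moreover have "char_poly ?A = map_poly complex_of_real (char_poly A)"
    by (rule of_real_hom.char_poly_hom[OF A])
  ultimately have "map_poly complex_of_real (char_poly A) = map_poly complex_of_real (monom 1 n)"
    by simp
  then have "char_poly A = monom 1 n"
    by (metis of_real_hom.coeff_map_poly_hom of_real_eq_iff poly_eqI)
  then have "char_poly A = (\<Prod>a\<leftarrow>replicate n 0. [:- a, 1:])"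
    by (simp add: monom_altdef)
  then show ?thesis using jordan_nf_exists[OF A] by blast
qed

end

theory Submission
  imports Defs
begin

text \<open>
  The theorem is invariant under conjugating \<open>N\<close> (\<open>class_locally_connected_at_similar\<close>), so let \<open>N\<close> be
  a Jordan matrix, and let \<open>J\<close> be a Jordan matrix in the class, with largest block size \<open>h\<close>. The
  numerical hypotheses give each block of \<open>N\<close> of size at least 2 its own block of \<open>J\<close> of size \<open>h\<close>,
  which is at least as large.

  Let \<open>A\<close> be an element of the class near \<open>N\<close>. Choose vectors near the generators of the large
  blocks of \<open>N\<close> and form their chains under \<open>A\<close>. Together with vectors near the kernel vectors of the
  zero blocks these form a basis near the standard one, so a short path of conjugations moves \<open>A\<close> to
  a matrix that agrees with \<open>N\<close> on all basis vectors outside the kernel of \<open>N\<close>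
  (\<open>conj_segment_path\<close>, \<open>frame_conj_col\<close>). If the chosen vectors are generic, they generate
  a free summand of height \<open>h\<close>, and the centraliser of \<open>J\<close> moves their images to standard
  generators of blocks of \<open>J\<close>. So \<open>A\<close> is moved to \<open>minv M * J * M\<close>, where the columns of \<open>M\<close> on the
  large blocks of \<open>N\<close> are fixed unit vectors and the other columns are arbitrary
  (\<open>generic_commutant\<close>, \<open>normal_form\<close>). The sign of \<open>det M\<close> is the only remaining invariant, and a
  zero block of \<open>J\<close> allows one to change it. The matrices \<open>M\<close> with given columns and positive
  determinant form a path connected set (\<open>pos_frames_path_connected\<close>), which joins the normal forms
  of any two elements of the class near \<open>N\<close>.

  This path need not stay near \<open>N\<close>. But conjugation by a diagonal matrix followed by scaling preserves
  the class, fixes \<open>N\<close> and shrinks all entries in the kernel columns of \<open>N\<close>, where alone the normal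
  forms differ from \<open>N\<close>. Contracting the path and connecting its ends to their contractions
  (\<open>contract_close\<close>, \<open>frames_connected\<close>, \<open>contract_path\<close>) gives a path that stays near \<open>N\<close>.
\<close>

section \<open>Continuity in the space of matrices\<close>

lemma mat_nbhd_iff:
  assumes "N \<in> carrier_mat n n"
  shows "B \<in> mat_nbhd n \<epsilon> N \<longleftrightarrow>
    B \<in> carrier_mat n n \<and> 0 < \<epsilon> \<and> (\<forall>i<n. \<forall>j<n. \<bar>B $$ (i, j) - N $$ (i, j)\<bar> < \<epsilon>)"
proof -
  have "max_norm (B - N) < \<epsilon> \<longleftrightarrow>
      0 < \<epsilon> \<and> (\<forall>i<n. \<forall>j<n. \<bar>(B - N) $$ (i, j)\<bar> < \<epsilon>)"
    by (rule max_norm_less_iff[OF minus_carrier_mat[OF assms]])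
  moreover have "(\<forall>i<n. \<forall>j<n. \<bar>(B - N) $$ (i, j)\<bar> < \<epsilon>) \<longleftrightarrow>
      (\<forall>i<n. \<forall>j<n. \<bar>B $$ (i, j) - N $$ (i, j)\<bar> < \<epsilon>)"
    using assms by simp
  ultimately show ?thesis
    unfolding mat_nbhd_def by blast
qed

lemma mat_nbhd_eq_mball:
  assumes "N \<in> carrier_mat n n"
  shows "mat_nbhd n \<epsilon> N = Metric_space.mball (carrier_mat n n) (mat_dist n) N \<epsilon>"
proof -
  have "B \<in> mat_nbhd n \<epsilon> N \<longleftrightarrow> B \<in> carrier_mat n n \<and> mat_dist n N B < \<epsilon>" for B
    using assms by (subst Metric_space.commute[OF Metric_space_mat]) (auto simp: mat_nbhd_def mat_dist_def)
  then show ?thesis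
    using assms by (auto simp: Metric_space.mball_def[OF Metric_space_mat])
qed

lemma openin_mat_nbhd:
  assumes "N \<in> carrier_mat n n"
  shows "openin (mat_topology n) (mat_nbhd n \<epsilon> N)"
  unfolding mat_nbhd_eq_mball[OF assms] mat_topology_def
  by (rule Metric_space.openin_mball[OF Metric_space_mat])

lemma openin_mat_topologyD:
  assumes "openin (mat_topology n) U" "N \<in> U"
  obtains r where "r > 0" "mat_nbhd n r N \<subseteq> U"
proof -
  have N: "N \<in> carrier_mat n n"
    using assms openin_subset by fastforce
  show ?thesis
    using assms that unfolding mat_topology_def Metric_space.openin_mtopology[OF Metric_space_mat]
      mat_nbhd_eq_mball[OF N] by blast
qed

text \<open>Continuity into the matrix space is entrywise continuity, which turns continuity of
  matrix expressions into arithmetic of real-valued functions.\<close>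

lemma continuous_map_mat_iff:
  "continuous_map X (mat_topology n) f \<longleftrightarrow>
    (\<forall>x\<in>topspace X. f x \<in> carrier_mat n n) \<and>
    (\<forall>i<n. \<forall>j<n. continuous_map X euclideanreal (\<lambda>x. f x $$ (i, j)))"
proof -
  let ?near = "\<lambda>x \<epsilon>. \<exists>U. openin X U \<and> x \<in> U \<and> (\<forall>y\<in>U. f y \<in> mat_nbhd n \<epsilon> (f x))"
  have carr: "f x \<in> carrier_mat n n" if "continuous_map X (mat_topology n) f" "x \<in> topspace X" for x
    using continuous_map_image_subset_topspace[OF that(1)] that(2) by auto
  have L: "continuous_map X (mat_topology n) f \<longleftrightarrow> (\<forall>x\<in>topspace X. \<forall>\<epsilon>>0. ?near x \<epsilon>)"
    if "\<forall>x\<in>topspace X. f x \<in> carrier_mat n n"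
    unfolding mat_topology_def Metric_space.continuous_map_to_metric[OF Metric_space_mat]
    using that by (intro ball_cong refl) (simp add: mat_nbhd_eq_mball)
  have R: "continuous_map X euclideanreal g \<longleftrightarrow>
    (\<forall>x\<in>topspace X. \<forall>\<epsilon>>0. \<exists>U. openin X U \<and> x \<in> U \<and> (\<forall>y\<in>U. \<bar>g y - g x\<bar> < \<epsilon>))" for g
    using Met_TC.continuous_map_to_metric[of X g, unfolded mtopology_is_euclidean]
    by (simp add: dist_real_def abs_minus_commute)
  show ?thesis
  proof (intro iffI conjI ballI allI impI; (elim conjE)?)
    fix x assume "continuous_map X (mat_topology n) f" "x \<in> topspace X"
    then show "f x \<in> carrier_mat n n" by (rule carr)
  next
    fix i j assume f: "continuous_map X (mat_topology n) f" and ij: "i < n" "j < n"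
    have near: "?near x \<epsilon>" if "x \<in> topspace X" "\<epsilon> > 0" for x \<epsilon>
      using L f carr that by blast
    show "continuous_map X euclideanreal (\<lambda>x. f x $$ (i, j))"
      unfolding R
    proof (intro ballI allI impI)
      fix x and \<epsilon> :: real assume x: "x \<in> topspace X" and e: "\<epsilon> > 0"
      obtain U where U: "openin X U" "x \<in> U" "\<forall>y\<in>U. f y \<in> mat_nbhd n \<epsilon> (f x)"
        using near[OF x e] by blast
      have "\<bar>f y $$ (i, j) - f x $$ (i, j)\<bar> < \<epsilon>" if "y \<in> U" for y
        using U(3) that ij mat_nbhd_iff[OF carr[OF f x]] by blast
      then show "\<exists>U. openin X U \<and> x \<in> U \<and> (\<forall>y\<in>U. \<bar>f y $$ (i, j) - f x $$ (i, j)\<bar> < \<epsilon>)"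
        using U by blast
    qed
  next
    assume c: "\<forall>x\<in>topspace X. f x \<in> carrier_mat n n"
      and e: "\<forall>i<n. \<forall>j<n. continuous_map X euclideanreal (\<lambda>x. f x $$ (i, j))"
    show "continuous_map X (mat_topology n) f"
      unfolding L[OF c]
    proof (intro ballI allI impI)
      fix x and \<epsilon> :: real assume x: "x \<in> topspace X" and eps: "\<epsilon> > 0"
      define U where "U i j = {y \<in> topspace X. f y $$ (i, j) \<in> ball (f x $$ (i, j)) \<epsilon>}" for i j
      have U: "openin X (U i j)" if "i < n" "j < n" for i j
        unfolding U_def using e that
        by (intro openin_continuous_map_preimage[of X euclideanreal]) auto
      define V where "V = topspace X \<inter> (\<Inter>(i, j) \<in> {..<n} \<times> {..<n}. U i j)"
      have "openin X V"
      proof (cases "n = 0")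
        case True then show ?thesis by (simp add: V_def)
      next
        case False
        then have "openin X (\<Inter> ((\<lambda>(i, j). U i j) ` ({..<n} \<times> {..<n})))"
          by (intro openin_Inter) (auto intro: U)
        then show ?thesis
          unfolding V_def by (intro openin_Int openin_topspace)
      qed
      moreover have "x \<in> V" using x eps by (auto simp: V_def U_def)
      moreover have "f y \<in> mat_nbhd n \<epsilon> (f x)" if "y \<in> V" for y
      proof -
        have "f y $$ (i, j) \<in> ball (f x $$ (i, j)) \<epsilon>" if "i < n" "j < n" for i j
          using \<open>y \<in> V\<close> that by (auto simp: V_def U_def)
        then have "\<forall>i<n. \<forall>j<n. \<bar>f y $$ (i, j) - f x $$ (i, j)\<bar> < \<epsilon>"
          by (simp add: dist_real_def abs_minus_commute)
        moreover have "f x \<in> carrier_mat n n" "f y \<in> carrier_mat n n"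
          using c x that by (auto simp: V_def)
        ultimately show ?thesis using eps mat_nbhd_iff by blast
      qed
      ultimately show "?near x \<epsilon>" by blast
    qed
  qed
qed

lemma continuous_map_matD:
  assumes "continuous_map X (mat_topology n) f"
  shows "x \<in> topspace X \<Longrightarrow> f x \<in> carrier_mat n n"
    and "i < n \<Longrightarrow> j < n \<Longrightarrow> continuous_map X euclideanreal (\<lambda>x. f x $$ (i, j))"
  using assms by (auto simp: continuous_map_mat_iff)

lemma continuous_map_mat_mult:
  assumes f: "continuous_map X (mat_topology n) f" and g: "continuous_map X (mat_topology n) g"
  shows "continuous_map X (mat_topology n) (\<lambda>x. f x * g x)"
  unfolding continuous_map_mat_iff
proof (intro conjI ballI allI impI)
  fix i j assume ij: "i < n" "j < n"
  have "continuous_map X euclideanreal (\<lambda>x. \<Sum>k<n. f x $$ (i, k) * g x $$ (k, j))"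
    using ij by (intro continuous_map_sum continuous_map_real_mult continuous_map_matD(2)[OF f]
        continuous_map_matD(2)[OF g]) auto
  moreover have "(f x * g x) $$ (i, j) = (\<Sum>k<n. f x $$ (i, k) * g x $$ (k, j))"
    if "x \<in> topspace X" for x
    using continuous_map_matD(1)[OF f that] continuous_map_matD(1)[OF g that] ij
    by (auto simp: scalar_prod_def lessThan_atLeast0)
  ultimately show "continuous_map X euclideanreal (\<lambda>x. (f x * g x) $$ (i, j))"
    by (smt (verit) continuous_map_eq)
qed (auto intro: mult_carrier_mat continuous_map_matD(1)[OF f] continuous_map_matD(1)[OF g])

lemma continuous_map_mat_const:
  "A \<in> carrier_mat n n \<Longrightarrow> continuous_map X (mat_topology n) (\<lambda>x. A)"
  by simp

lemma continuous_map_mat_pow: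
  assumes f: "continuous_map X (mat_topology n) f"
  shows "continuous_map X (mat_topology n) (\<lambda>x. f x ^\<^sub>m k)"
proof (induction k)
  case 0
  have "continuous_map X (mat_topology n) (\<lambda>x. 1\<^sub>m n)" by simp
  then show ?case
    by (rule continuous_map_eq) (use continuous_map_matD(1)[OF f] in fastforce)
next
  case (Suc k)
  then show ?case by (simp add: continuous_map_mat_mult f)
qed

lemma continuous_map_det:
  assumes c: "\<And>x. x \<in> topspace X \<Longrightarrow> f x \<in> carrier_mat n n"
    and e: "\<And>i j. i < n \<Longrightarrow> j < n \<Longrightarrow> continuous_map X euclideanreal (\<lambda>x. f x $$ (i, j))"
  shows "continuous_map X euclideanreal (\<lambda>x. det (f x))"
proof (rule continuous_map_eq)
  show "continuous_map X euclideanreal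
      (\<lambda>x. \<Sum>p | p permutes {0..<n}. signof p * (\<Prod>i = 0..<n. f x $$ (i, p i)))"
  proof (intro continuous_map_sum continuous_map_real_mult continuous_map_prod e)
    show "finite {p. p permutes {0..<n}}" by (simp add: finite_permutations)
  qed (auto simp: permutes_in_image)
qed (simp add: det_def'[OF c])

text \<open>The adjugate formula exhibits the inverse as a continuous function of the entries.\<close>

definition minv :: "real mat \<Rightarrow> real mat" where
  "minv A = (1 / det A) \<cdot>\<^sub>m adj_mat A"

lemma minv:
  assumes A: "A \<in> carrier_mat n n"
  shows "minv A \<in> carrier_mat n n"
    and "det A \<noteq> 0 \<Longrightarrow> minv A * A = 1\<^sub>m n" and "det A \<noteq> 0 \<Longrightarrow> A * minv A = 1\<^sub>m n"
proof -
  have s: "(1 / det A) \<cdot>\<^sub>m (det A \<cdot>\<^sub>m 1\<^sub>m n) = 1\<^sub>m n" if "det A \<noteq> 0"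
    using that by (intro eq_matI) auto
  show "minv A \<in> carrier_mat n n" using adj_mat[OF A] by (simp add: minv_def)
  show "minv A * A = 1\<^sub>m n" if "det A \<noteq> 0"
    unfolding minv_def mult_smult_assoc_mat[OF adj_mat(1)[OF A] A] adj_mat(3)[OF A] by (rule s[OF that])
  show "A * minv A = 1\<^sub>m n" if "det A \<noteq> 0"
    unfolding minv_def mult_smult_distrib[OF A adj_mat(1)[OF A]] adj_mat(2)[OF A] by (rule s[OF that])
qed

lemma continuous_map_minv:
  assumes f: "continuous_map X (mat_topology n) f" and d: "\<And>x. x \<in> topspace X \<Longrightarrow> det (f x) \<noteq> 0"
  shows "continuous_map X (mat_topology n) (\<lambda>x. minv (f x))"
  unfolding continuous_map_mat_iff
proof (intro conjI ballI allI impI)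
  note c = continuous_map_matD(1)[OF f]
  fix i j assume ij: "i < n" "j < n"
  have D: "continuous_map X euclideanreal (\<lambda>x. det (mat_delete (f x) j i))"
  proof (rule continuous_map_det)
    fix a b assume ab: "a < n - 1" "b < n - 1"
    let ?a = "if a < j then a else Suc a" and ?b = "if b < i then b else Suc b"
    have "continuous_map X euclideanreal (\<lambda>x. f x $$ (?a, ?b))"
      using ab by (intro continuous_map_matD(2)[OF f]) auto
    moreover have "f x $$ (?a, ?b) = mat_delete (f x) j i $$ (a, b)" if "x \<in> topspace X" for x
      using c[OF that] ab by (simp add: mat_delete_def)
    ultimately show "continuous_map X euclideanreal (\<lambda>x. mat_delete (f x) j i $$ (a, b))"
      by (rule continuous_map_eq)
  qed (use c mat_delete_carrier in blast)
  have "continuous_map X euclideanreal (\<lambda>x. 1 / det (f x))"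
    by (rule continuous_map_real_divide) (use c d continuous_map_det[OF c continuous_map_matD(2)[OF f]] in auto)
  then have "continuous_map X euclideanreal (\<lambda>x. 1 / det (f x) * ((-1) ^ (j + i) * det (mat_delete (f x) j i)))"
    by (rule continuous_map_real_mult) (rule continuous_map_real_mult[OF _ D], simp)
  moreover have "1 / det (f x) * ((-1) ^ (j + i) * det (mat_delete (f x) j i)) = minv (f x) $$ (i, j)"
    if "x \<in> topspace X" for x
    using c[OF that] ij by (simp add: minv_def adj_mat_def cofactor_def)
  ultimately show "continuous_map X euclideanreal (\<lambda>x. minv (f x) $$ (i, j))"
    by (rule continuous_map_eq)
qed (use continuous_map_matD(1)[OF f] minv(1) in blast)

text \<open>Continuity of conjugation at the pair of \<open>N\<close> and the identity.\<close>

lemma small_conjugation: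
  assumes N: "N \<in> carrier_mat n n" and e: "\<epsilon> > 0"
  obtains r where "r > 0"
    "\<And>A G. A \<in> mat_nbhd n r N \<Longrightarrow> G \<in> mat_nbhd n r (1\<^sub>m n) \<Longrightarrow>
       det G > 0 \<and> minv G * A * G \<in> mat_nbhd n \<epsilon> N"
proof -
  let ?M = "mat_topology n"
  have I: "1\<^sub>m n \<in> carrier_mat n n" by simp
  have "openin ?M {x \<in> topspace ?M. det x \<in> {0<..}}"
    by (rule openin_continuous_map_preimage[of _ euclideanreal])
      (auto intro!: continuous_map_det[of _ _ n] continuous_map_matD(2)[OF continuous_map_id[unfolded id_def]])
  then obtain r1 where r1: "r1 > 0" "mat_nbhd n r1 (1\<^sub>m n) \<subseteq> {x \<in> topspace ?M. det x \<in> {0<..}}"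
    by (rule openin_mat_topologyD[of _ _ "1\<^sub>m n"]) auto
  let ?P = "mat_nbhd n r1 (1\<^sub>m n)"
  have P: "?P \<subseteq> carrier_mat n n" by (auto simp: mat_nbhd_def)
  let ?X = "prod_topology ?M (subtopology ?M ?P)"
  have top: "topspace ?X = carrier_mat n n \<times> ?P" using P by auto
  have s: "continuous_map ?X ?M snd"
    using continuous_map_snd[of ?M "subtopology ?M ?P"] continuous_map_in_subtopology by blast
  have "continuous_map ?X ?M (\<lambda>x. minv (snd x) * fst x * snd x)"
    using r1(2) by (intro continuous_map_mat_mult continuous_map_minv s continuous_map_fst) auto
  then have "openin ?X {x \<in> topspace ?X. minv (snd x) * fst x * snd x \<in> mat_nbhd n \<epsilon> N}"
    using openin_mat_nbhd[OF N] by (rule openin_continuous_map_preimage)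
  moreover have "(N, 1\<^sub>m n) \<in> {x \<in> topspace ?X. minv (snd x) * fst x * snd x \<in> mat_nbhd n \<epsilon> N}"
    using N e r1(1) minv[OF I] by (auto simp: top mat_nbhd_iff)
  ultimately obtain U V where U: "openin ?M U" "N \<in> U" and V: "openin (subtopology ?M ?P) V" "1\<^sub>m n \<in> V"
    and UV: "U \<times> V \<subseteq> {x \<in> topspace ?X. minv (snd x) * fst x * snd x \<in> mat_nbhd n \<epsilon> N}"
    unfolding openin_prod_topology_alt by blast
  obtain r2 where r2: "r2 > 0" "mat_nbhd n r2 N \<subseteq> U"
    using openin_mat_topologyD U by blast
  have "openin ?M V"
    using V(1) openin_mat_nbhd[OF I] openin_trans_full by blast
  then obtain r3 where r3: "r3 > 0" "mat_nbhd n r3 (1\<^sub>m n) \<subseteq> V"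
    using openin_mat_topologyD V by blast
  show ?thesis
  proof (rule that)
    show "min r2 r3 > 0" using r2 r3 by simp
    fix A G assume "A \<in> mat_nbhd n (min r2 r3) N" "G \<in> mat_nbhd n (min r2 r3) (1\<^sub>m n)"
    then have "A \<in> U" "G \<in> V" using r2 r3 by (auto simp: mat_nbhd_def)
    then have "(A, G) \<in> {x \<in> topspace ?X. minv (snd x) * fst x * snd x \<in> mat_nbhd n \<epsilon> N}"
      using UV by blast
    then show "det G > 0 \<and> minv G * A * G \<in> mat_nbhd n \<epsilon> N"
      using r1(2) by (auto simp: top)
  qed
qed

section \<open>Paths of matrices\<close>

abbreviation mpath :: "nat \<Rightarrow> real mat set \<Rightarrow> real mat \<Rightarrow> real mat \<Rightarrow> bool" where
  "mpath n S \<equiv> path_component_of (subtopology (mat_topology n) S)"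

lemma mpathI:
  fixes \<gamma> :: "real \<Rightarrow> real mat"
  assumes "continuous_map (top_of_set {0..1}) (mat_topology n) \<gamma>"
    and "\<And>t. 0 \<le> t \<Longrightarrow> t \<le> 1 \<Longrightarrow> \<gamma> t \<in> S" and "\<gamma> 0 = A" and "\<gamma> 1 = B"
  shows "mpath n S A B"
  using assms unfolding path_component_of_def pathin_def continuous_map_in_subtopology
  by (intro exI[of _ \<gamma>]) auto

lemma mpathE:
  assumes "mpath n S A B"
  obtains \<gamma> :: "real \<Rightarrow> real mat" where "continuous_map (top_of_set {0..1}) (mat_topology n) \<gamma>"
    and "\<And>t. 0 \<le> t \<Longrightarrow> t \<le> 1 \<Longrightarrow> \<gamma> t \<in> S" and "\<gamma> 0 = A" and "\<gamma> 1 = B"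
  using assms unfolding path_component_of_def pathin_def continuous_map_in_subtopology by force

lemma mpath_mono: "mpath n S A B \<Longrightarrow> S \<subseteq> T \<Longrightarrow> mpath n T A B"
  by (erule mpathE) (rule mpathI, assumption, blast)

lemma mpath_endpoints:
  assumes "mpath n S A B"
  shows "A \<in> S" "B \<in> S"
  using assms by (auto elim!: mpathE)

definition segment :: "nat \<Rightarrow> real mat \<Rightarrow> real mat \<Rightarrow> real \<Rightarrow> real mat" where
  "segment n A B t = mat n n (\<lambda>(i, j). (1 - t) * A $$ (i, j) + t * B $$ (i, j))"

lemma segment_carrier [simp]: "segment n A B t \<in> carrier_mat n n"
  by (simp add: segment_def)

lemma segment_endpoints:
  assumes "A \<in> carrier_mat n n" "B \<in> carrier_mat n n"
  shows "segment n A B 0 = A" "segment n A B 1 = B"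
  using assms by (auto simp: segment_def intro!: eq_matI)

lemma continuous_map_segment:
  "continuous_map (top_of_set {0..1}) (mat_topology n) (segment n A B)"
proof -
  have "continuous_on {0..1} (\<lambda>t. segment n A B t $$ (i, j))" if "i < n" "j < n" for i j
    using that by (auto simp: segment_def intro!: continuous_intros)
  then show ?thesis by (auto simp: continuous_map_mat_iff)
qed

lemma mpath_segment:
  assumes "A \<in> carrier_mat n n" "B \<in> carrier_mat n n"
    and "\<And>t. 0 \<le> t \<Longrightarrow> t \<le> 1 \<Longrightarrow> segment n A B t \<in> S"
  shows "mpath n S A B"
  by (rule mpathI[OF continuous_map_segment]) (use assms segment_endpoints in auto)

section \<open>Connectedness of frames with prescribed columns\<close>

text \<open>The columns are read as a basis: those outside \<open>Y\<close> are prescribed, those in \<open>Y\<close> are free,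
  and the orientation is fixed because the two orientations cannot be joined.\<close>

definition pos_frames :: "nat \<Rightarrow> nat set \<Rightarrow> real mat \<Rightarrow> real mat set" where
  "pos_frames n Y M' = {X \<in> carrier_mat n n. det X > 0 \<and>
     (\<forall>i<n. \<forall>j<n. j \<notin> Y \<longrightarrow> X $$ (i, j) = M' $$ (i, j))}"

lemma mult_mat_unit_vec:
  fixes A :: "real mat"
  assumes "A \<in> carrier_mat n n" "j < n"
  shows "A *\<^sub>v unit_vec n j = col A j"
  using assms by (intro eq_vecI) (auto simp: scalar_prod_right_unit)

text \<open>By Cramer's rule the determinant along the segment is affine in the coordinate of the new
  column along the old one, so a positive coordinate keeps it positive.\<close>

lemma mpath_replace_col:
  assumes M: "M \<in> pos_frames n Y M'" and y: "y < n" "y \<in> Y"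
    and c: "c \<in> carrier_vec n" "vec_index c y > 0"
  shows "mpath n (pos_frames n Y M') M (replace_col M (M *\<^sub>v c) y)"
proof (rule mpath_segment)
  have Mc: "M \<in> carrier_mat n n" and dM: "det M > 0" using M by (auto simp: pos_frames_def)
  then show "M \<in> carrier_mat n n" "replace_col M (M *\<^sub>v c) y \<in> carrier_mat n n"
    by (auto simp: replace_col_def)
  fix t :: real assume t: "0 \<le> t" "t \<le> 1"
  let ?c = "(1 - t) \<cdot>\<^sub>v unit_vec n y + t \<cdot>\<^sub>v c"
  have "M *\<^sub>v ?c = (1 - t) \<cdot>\<^sub>v col M y + t \<cdot>\<^sub>v (M *\<^sub>v c)"
    using Mc c y by (simp add: mult_add_distrib_mat_vec mult_mat_vec mult_mat_unit_vec)
  then have "segment n M (replace_col M (M *\<^sub>v c) y) t = replace_col M (M *\<^sub>v ?c) y"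
    using Mc c y by (intro eq_matI) (auto simp: segment_def replace_col_def algebra_simps)
  moreover have "det (replace_col M (M *\<^sub>v ?c) y) = vec_index ?c y * det M"
    by (rule cramer_lemma_mat[OF Mc _ y(1)]) (use c in auto)
  moreover have "vec_index ?c y > 0"
  proof -
    have "vec_index ?c y = (1 - t) + t * vec_index c y" using c y by simp
    moreover have "(1 - t) + t * vec_index c y > 0"
      using t c(2) by (cases "t = 1") (auto intro: add_pos_nonneg)
    ultimately show ?thesis by simp
  qed
  ultimately show "segment n M (replace_col M (M *\<^sub>v c) y) t \<in> pos_frames n Y M'"
    using dM M Mc y by (auto simp: pos_frames_def replace_col_def)
qed

lemma mpath_addcol:
  assumes M: "M \<in> pos_frames n Y M'" and k: "k < n" "k \<in> Y" and l: "l < n" "l \<noteq> k"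
  shows "mpath n (pos_frames n Y M') M (addcol a k l M)" and "addcol a k l M \<in> pos_frames n Y M'"
proof -
  have Mc: "M \<in> carrier_mat n n" and dM: "det M > 0" using M by (auto simp: pos_frames_def)
  have add: "addcol s k l M \<in> pos_frames n Y M'" for s
    using M k l Mc det_addcol[OF l(1) _ Mc, of k s] by (auto simp: pos_frames_def)
  show "addcol a k l M \<in> pos_frames n Y M'" by (rule add)
  show "mpath n (pos_frames n Y M') M (addcol a k l M)"
  proof (rule mpath_segment)
    show "M \<in> carrier_mat n n" "addcol a k l M \<in> carrier_mat n n" using Mc by auto
    fix t :: real
    have "segment n M (addcol a k l M) t = addcol (t * a) k l M"
      using Mc k l by (intro eq_matI) (auto simp: segment_def algebra_simps)
    then show "segment n M (addcol a k l M) t \<in> pos_frames n Y M'" by (simp add: add)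
  qed
qed

text \<open>How the coordinates of a fixed vector change when the basis is sheared.\<close>

lemma addcol_mult_vec:
  fixes A :: "real mat"
  assumes A: "A \<in> carrier_mat n n" and v: "v \<in> carrier_vec n" and kl: "k < n" "l < n" "k \<noteq> l"
  shows "addcol a k l A *\<^sub>v vec n (\<lambda>j. vec_index v j - (if j = l then a * vec_index v k else 0)) = A *\<^sub>v v"
proof (rule eq_vecI)
  fix i assume "i < dim_vec (A *\<^sub>v v)"
  then have i: "i < n" using A by simp
  let ?v = "vec_index v"
  have "(addcol a k l A *\<^sub>v vec n (\<lambda>j. ?v j - (if j = l then a * ?v k else 0))) $ i
     = (\<Sum>j<n. A $$ (i, j) * ?v j + ((if j = k then a * A $$ (i, l) * ?v k else 0)
         - (if j = l then a * A $$ (i, l) * ?v k else 0)))"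
    using A v i kl by (auto simp: scalar_prod_def lessThan_atLeast0 algebra_simps intro!: sum.cong)
  also have "\<dots> = (\<Sum>j<n. A $$ (i, j) * ?v j)"
    using kl by (simp add: sum.distrib sum_subtractf)
  also have "\<dots> = vec_index (A *\<^sub>v v) i"
    using A v i by (auto simp: scalar_prod_def lessThan_atLeast0 intro!: sum.cong)
  finally show "vec_index (addcol a k l A *\<^sub>v vec n (\<lambda>j. ?v j - (if j = l then a * ?v k else 0))) i
     = vec_index (A *\<^sub>v v) i" .
qed (use A in auto)

text \<open>The desired column \<open>q\<close> can replace column \<open>y\<close> along a segment as soon as its coordinate
  along that column is positive. If it is not, a shear involving a second free column, which does
  not change the determinant, makes it positive. A second free column is missing only if \<open>M\<close> and
  \<open>M'\<close> differ in column \<open>y\<close> alone, and then the coordinate is the ratio of their determinants.\<close>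

lemma adjust_column:
  assumes M: "M \<in> pos_frames n (insert y Y) M'" and M': "M' \<in> carrier_mat n n" "det M' > 0"
    and Y: "insert y Y \<subseteq> {..<n}" "y \<notin> Y"
  obtains M1 where "M1 \<in> pos_frames n Y M'" "mpath n (pos_frames n (insert y Y) M') M M1"
proof -
  let ?F = "pos_frames n (insert y Y) M'"
  note result = that
  define q where "q = col M' y"
  have y: "y < n" using Y by auto
  have q: "q \<in> carrier_vec n" using M' unfolding q_def by auto
  have carr: "X \<in> carrier_mat n n" "det X > 0" if "X \<in> ?F" for X
    using that by (auto simp: pos_frames_def)
  have single: thesis
    if X: "X \<in> ?F" "mpath n ?F M X" and c: "c \<in> carrier_vec n" "X *\<^sub>v c = q" "vec_index c y > 0" for X c
  proof (rule result)
    have p: "mpath n ?F X (replace_col X q y)"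
      using mpath_replace_col[OF X(1) y _ c(1,3)] c(2) by simp
    then show "mpath n ?F M (replace_col X q y)"
      by (rule path_component_of_trans[OF X(2)])
    have "replace_col X q y \<in> ?F"
      using p by (rule mpath_endpoints(2))
    then show "replace_col X q y \<in> pos_frames n Y M'"
      using carr[OF X(1)] M' y by (auto simp: pos_frames_def replace_col_def q_def)
  qed
  have via_shear: thesis
    if X: "X \<in> ?F" "mpath n ?F M X" and c: "c \<in> carrier_vec n" "X *\<^sub>v c = q"
      and b: "b \<in> Y" "vec_index c b \<noteq> 0" for X c b
  proof -
    \<comment> \<open>this amount of shear makes the coordinate of \<open>q\<close> along column \<open>y\<close> equal to 1\<close>
    define a where "a = (vec_index c y - 1) / vec_index c b"
    have bn: "b < n" "b \<noteq> y" using b Y by auto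
    define c' where "c' = vec n (\<lambda>j. vec_index c j - (if j = y then a * vec_index c b else 0))"
    have F: "addcol a b y X \<in> ?F" and p: "mpath n ?F X (addcol a b y X)"
      using mpath_addcol[OF X(1) bn(1) _ y] b bn by auto
    have eq: "addcol a b y X *\<^sub>v c' = q"
      unfolding c'_def using addcol_mult_vec[OF carr(1)[OF X(1)] c(1) bn(1) y bn(2)] c(2) by simp
    have "c' \<in> carrier_vec n" "vec_index c' y > 0"
      using b y unfolding c'_def a_def by auto
    then show thesis
      using single[OF F path_component_of_trans[OF X(2) p] _ eq] by simp
  qed
  have Mc: "M \<in> carrier_mat n n" and dM: "det M > 0" using carr[OF M] by auto
  have MM: "mpath n ?F M M"
    using M Mc by (simp add: path_component_of_refl)
  define c where "c = minv M *\<^sub>v q"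
  have c: "c \<in> carrier_vec n" using minv(1)[OF Mc] q by (auto simp: c_def)
  have "M *\<^sub>v c = (M * minv M) *\<^sub>v q"
    unfolding c_def by (rule assoc_mult_mat_vec[symmetric]) (use Mc minv(1) q in auto)
  then have Mq: "M *\<^sub>v c = q" using minv(3)[OF Mc] dM q by simp
  show thesis
  proof (cases "\<exists>b\<in>Y. vec_index c b \<noteq> 0")
    case True
    then show thesis using via_shear[OF M MM c Mq] by blast
  next
    case zero: False
    have cy: "vec_index c y \<noteq> 0"
    proof
      \<comment> \<open>otherwise \<open>q\<close> is a combination of the prescribed columns, and \<open>M'\<close> is singular\<close>
      assume cy: "vec_index c y = 0"
      define v where "v = vec n (\<lambda>j. if j = y then -1 else vec_index c j)"
      have "M' *\<^sub>v v = 0\<^sub>v n"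
      proof (rule eq_vecI)
        fix i assume "i < dim_vec (0\<^sub>v n :: real vec)"
        then have i: "i < n" by simp
        have "vec_index (M' *\<^sub>v v) i = (\<Sum>j<n. M $$ (i, j) * vec_index c j - (if j = y then vec_index q i else 0))"
          using i M' M cy zero Y y
          by (auto simp: v_def scalar_prod_def lessThan_atLeast0 q_def pos_frames_def intro!: sum.cong)
        also have "\<dots> = vec_index (M *\<^sub>v c) i - vec_index q i"
          using i Mc c y by (simp add: sum_subtractf scalar_prod_def lessThan_atLeast0)
        finally show "vec_index (M' *\<^sub>v v) i = vec_index (0\<^sub>v n) i" using Mq i by simp
      qed (use M' in auto)
      moreover have "v \<noteq> 0\<^sub>v n"
      proof
        assume "v = 0\<^sub>v n"
        then have "vec_index v y = 0" using y by simp
        then show False using y by (simp add: v_def)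
      qed
      moreover have "v \<in> carrier_vec n" by (simp add: v_def)
      ultimately have "det M' = 0"
        using det_0_iff_vec_prod_zero[OF M'(1)] by blast
      then show False using M' by simp
    qed
    show thesis
    proof (cases "vec_index c y > 0")
      case True
      then show thesis using single[OF M MM c Mq] by blast
    next
      case neg: False
      have "Y \<noteq> {}"
      proof
        assume "Y = {}"
        then have "replace_col M q y = M'"
          using M M' Mc y by (intro eq_matI) (auto simp: replace_col_def q_def pos_frames_def)
        then have "det M' = vec_index c y * det M"
          using cramer_lemma_mat[OF Mc c y] Mq by simp
        then show False using M'(2) dM neg by (simp add: zero_less_mult_iff)
      qed
      then obtain b where b: "b \<in> Y" by auto
      then have bn: "b < n" "y \<noteq> b" using Y by auto
      \<comment> \<open>shearing column \<open>y\<close> by column \<open>b\<close> creates a nonzero coordinate along \<open>b\<close>\<close>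
      define c' where "c' = vec n (\<lambda>j. vec_index c j - (if j = b then 1 * vec_index c y else 0))"
      have eq: "addcol 1 y b M *\<^sub>v c' = q"
        unfolding c'_def using addcol_mult_vec[OF Mc c y bn] Mq by simp
      have c': "c' \<in> carrier_vec n" "vec_index c' b \<noteq> 0"
        using cy zero b bn by (auto simp: c'_def)
      have "addcol 1 y b M \<in> ?F" "mpath n ?F M (addcol 1 y b M)"
        using mpath_addcol[OF M y _ bn(1)] bn by auto
      then show thesis using via_shear c'(1) eq b c'(2) by simp
    qed
  qed
qed

text \<open>In particular the invertible matrices of positive determinant are path connected (take all
  columns free). The prescribed columns are what the main argument needs: they carry Jordan
  chains.\<close>

lemma pos_frames_path_connected:
  assumes "finite Y" "Y \<subseteq> {..<n}" and M': "M' \<in> carrier_mat n n" "det M' > 0"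
    and "M \<in> pos_frames n Y M'"
  shows "mpath n (pos_frames n Y M') M M'"
  using assms(1,2,5)
proof (induction Y arbitrary: M rule: finite_induct)
  case empty
  then have "M = M'" using M' by (intro eq_matI) (auto simp: pos_frames_def)
  then show ?case using empty M' by (simp add: path_component_of_refl)
next
  case (insert y Y)
  obtain M1 where M1: "M1 \<in> pos_frames n Y M'" "mpath n (pos_frames n (insert y Y) M') M M1"
    using adjust_column[OF insert.prems(2) M' insert.prems(1) insert.hyps(2)] by blast
  have "mpath n (pos_frames n Y M') M1 M'"
    using insert.IH M1(1) insert.prems(1) by auto
  then have "mpath n (pos_frames n (insert y Y) M') M1 M'"
    by (rule mpath_mono) (auto simp: pos_frames_def)
  then show ?case by (rule path_component_of_trans[OF M1(2)])
qed

section \<open>Conjugation\<close>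

lemma mat_eq_by_cols:
  assumes "A \<in> carrier_mat n n" "B \<in> carrier_mat n n" "\<And>j. j < n \<Longrightarrow> col A j = col B j"
  shows "A = B"
  using assms by (intro mat_col_eqI) auto

lemma pow_mat_Suc_vec:
  fixes A :: "real mat"
  assumes "A \<in> carrier_mat n n" "v \<in> carrier_vec n"
  shows "A ^\<^sub>m Suc d *\<^sub>v v = A ^\<^sub>m d *\<^sub>v (A *\<^sub>v v)"
  using assoc_mult_mat_vec[OF pow_carrier_mat[OF assms(1)] assms] by simp

lemma minv_conj_similar:
  assumes "G \<in> carrier_mat n n" "det G \<noteq> 0" "A \<in> carrier_mat n n"
  shows "similar_mat (minv G * A * G) A"
  by (rule similar_matI[of _ _ "minv G" G n]) (use assms minv[OF assms(1)] in auto)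

lemma eq_minv_conjI:
  assumes M: "M \<in> carrier_mat n n" "det M \<noteq> 0" and c: "X \<in> carrier_mat n n" "J \<in> carrier_mat n n"
    and eq: "M * X = J * M"
  shows "X = minv M * J * M"
proof -
  note mi = minv[OF M(1)]
  have "minv M * J * M = minv M * (M * X)"
    unfolding eq by (rule assoc_mult_mat) (use mi M c in auto)
  also have "\<dots> = minv M * M * X"
    by (rule assoc_mult_mat[symmetric]) (use mi M c in auto)
  finally show ?thesis using mi(2) M c by simp
qed

lemma diagonal_rescaling_similar:
  fixes B :: "real mat"
  assumes B: "B \<in> carrier_mat n n" and f: "\<And>a. a < n \<Longrightarrow> f a \<noteq> 0"
  shows "similar_mat (mat n n (\<lambda>(a, b). f a * B $$ (a, b) / f b)) B"
proof (rule similar_matI[of _ _ "mat_diag n f" "mat_diag n (\<lambda>a. 1 / f a)" n])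
  show "mat_diag n f * mat_diag n (\<lambda>a. 1 / f a) = 1\<^sub>m n"
    "mat_diag n (\<lambda>a. 1 / f a) * mat_diag n f = 1\<^sub>m n"
    unfolding mat_diag_diag using f by (auto simp: mat_diag_def intro!: eq_matI)
  show "mat n n (\<lambda>(a, b). f a * B $$ (a, b) / f b) = mat_diag n f * B * mat_diag n (\<lambda>a. 1 / f a)"
    using B by (auto simp: mat_diag_mult_left mat_diag_mult_right[of _ n] intro!: eq_matI)
qed (use B in auto)

lemma pow_mat_intertwine:
  fixes A B P :: "real mat"
  assumes A: "A \<in> carrier_mat n n" and B: "B \<in> carrier_mat n n" and P: "P \<in> carrier_mat n n"
    and AB: "P * A = B * P"
  shows "P * A ^\<^sub>m k = B ^\<^sub>m k * P"
proof (induction k)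
  case 0
  then show ?case using A B P by simp
next
  case (Suc k)
  have p: "A ^\<^sub>m k \<in> carrier_mat n n" "B ^\<^sub>m k \<in> carrier_mat n n" using A B by auto
  have "P * A ^\<^sub>m Suc k = B ^\<^sub>m k * P * A"
    using assoc_mult_mat[OF P p(1) A] Suc.IH by simp
  also have "\<dots> = B ^\<^sub>m Suc k * P"
    using assoc_mult_mat[OF p(2) P A] assoc_mult_mat[OF p(2) B P] AB by simp
  finally show ?case .
qed

text \<open>Conjugation is a homeomorphism that preserves the class, so a Jordan form may replace the given
  matrix.\<close>

lemma class_locally_connected_at_similar:
  assumes M: "class_locally_connected_at n \<C> M" and sim: "similar_mat N M" and N: "N \<in> carrier_mat n n"
    and closed: "\<And>A B. A \<in> \<C> \<Longrightarrow> similar_mat B A \<Longrightarrow> B \<in> \<C>"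
  shows "class_locally_connected_at n \<C> N"
proof -
  let ?M = "mat_topology n"
  obtain P Q where PQ: "similar_mat_wit N M P Q" using sim by (auto simp: similar_mat_def)
  note w = similar_mat_witD2[OF N PQ]
  define f where "f X Y B = X * B * Y" for X Y B :: "real mat"
  have carr: "f X Y B \<in> carrier_mat n n"
    if "X \<in> carrier_mat n n" "Y \<in> carrier_mat n n" "B \<in> carrier_mat n n" for X Y B
    using that unfolding f_def by (intro mult_carrier_mat)
  have cont: "continuous_map ?M ?M (f X Y)" if "X \<in> carrier_mat n n" "Y \<in> carrier_mat n n" for X Y
    unfolding f_def using that
    by (intro continuous_map_mat_mult continuous_map_mat_const continuous_map_id[unfolded id_def])
  have inverse: "f X Y (f Y X B) = B"
    if "X \<in> carrier_mat n n" "Y \<in> carrier_mat n n" "X * Y = 1\<^sub>m n" "B \<in> carrier_mat n n" for X Y B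
  proof -
    have "f X Y (f Y X B) = X * Y * B * (X * Y)"
      unfolding f_def using that(1,2,4) by (simp add: assoc_mult_mat[of _ n n _ n _ n] del: that(3))
    then show ?thesis using that by simp
  qed
  have similar: "similar_mat (f X Y B) B"
    if "X \<in> carrier_mat n n" "Y \<in> carrier_mat n n" "X * Y = 1\<^sub>m n" "Y * X = 1\<^sub>m n" "B \<in> carrier_mat n n" for X Y B
    by (rule similar_matI[of _ _ X Y n]) (use that carr in \<open>auto simp: f_def\<close>)
  have fM: "f P Q M = N" using w(3) by (simp add: f_def)
  then have gN: "f Q P N = M" using inverse[OF w(7,6,2,5)] by simp
  have nearby: "\<exists>d>0. mat_nbhd n d B \<subseteq> {x \<in> topspace ?M. f X Y x \<in> mat_nbhd n e (f X Y B)}"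
    if "X \<in> carrier_mat n n" "Y \<in> carrier_mat n n" "B \<in> carrier_mat n n" "e > 0" for X Y B e
  proof -
    have "openin ?M {x \<in> topspace ?M. f X Y x \<in> mat_nbhd n e (f X Y B)}"
      by (rule openin_continuous_map_preimage[OF cont[OF that(1,2)] openin_mat_nbhd[OF carr[OF that(1-3)]]])
    moreover have "f X Y B \<in> mat_nbhd n e (f X Y B)"
      using mat_nbhd_iff[OF carr[OF that(1-3)]] carr[OF that(1-3)] that(4) by simp
    ultimately show ?thesis
      using that(3) by (elim openin_mat_topologyD[of n _ B]) auto
  qed
  show ?thesis
    unfolding class_locally_connected_at_def
  proof (intro allI impI)
    fix \<epsilon> :: real assume "\<epsilon> > 0"
    then obtain \<epsilon>' where e': "\<epsilon>' > 0" "mat_nbhd n \<epsilon>' M \<subseteq> {x \<in> topspace ?M. f P Q x \<in> mat_nbhd n \<epsilon> N}"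
      using nearby[OF w(6,7,5), of \<epsilon>] fM by auto
    obtain \<delta>' where d': "\<delta>' > 0" and path: "\<And>A B. A \<in> \<C> \<inter> mat_nbhd n \<delta>' M \<Longrightarrow> B \<in> \<C> \<inter> mat_nbhd n \<delta>' M \<Longrightarrow>
        mpath n (\<C> \<inter> mat_nbhd n \<epsilon>' M) A B"
      using M e'(1) unfolding class_locally_connected_at_def by meson
    obtain \<delta> where d: "\<delta> > 0" "mat_nbhd n \<delta> N \<subseteq> {x \<in> topspace ?M. f Q P x \<in> mat_nbhd n \<delta>' M}"
      using nearby[OF w(7,6,4) d'] gN by auto
    have "mpath n (\<C> \<inter> mat_nbhd n \<epsilon> N) A B"
      if A: "A \<in> \<C> \<inter> mat_nbhd n \<delta> N" and B: "B \<in> \<C> \<inter> mat_nbhd n \<delta> N" for A B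
    proof -
      have back_in: "f Q P X \<in> \<C> \<inter> mat_nbhd n \<delta>' M" "f P Q (f Q P X) = X" if "X \<in> \<C> \<inter> mat_nbhd n \<delta> N" for X
      proof -
        have X: "X \<in> \<C>" "X \<in> carrier_mat n n" "f Q P X \<in> mat_nbhd n \<delta>' M"
          using that d(2) by (auto simp: mat_nbhd_def)
        show "f Q P X \<in> \<C> \<inter> mat_nbhd n \<delta>' M"
          using X closed[OF X(1) similar[OF w(7,6,2,1) X(2)]] by simp
        show "f P Q (f Q P X) = X" by (rule inverse[OF w(6,7,1) X(2)])
      qed
      have "mpath n (\<C> \<inter> mat_nbhd n \<epsilon>' M) (f Q P A) (f Q P B)"
        by (rule path[OF back_in(1)[OF A] back_in(1)[OF B]])
      then obtain \<gamma> :: "real \<Rightarrow> real mat" where g: "continuous_map (top_of_set {0..1}) ?M \<gamma>"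
        "\<And>t. 0 \<le> t \<Longrightarrow> t \<le> 1 \<Longrightarrow> \<gamma> t \<in> \<C> \<inter> mat_nbhd n \<epsilon>' M" "\<gamma> 0 = f Q P A" "\<gamma> 1 = f Q P B"
        by (rule mpathE) blast
      show ?thesis
      proof (rule mpathI[where \<gamma> = "f P Q \<circ> \<gamma>"])
        show "continuous_map (top_of_set {0..1}) ?M (f P Q \<circ> \<gamma>)"
          by (rule continuous_map_compose[OF g(1) cont[OF w(6,7)]])
        fix t :: real assume "0 \<le> t" "t \<le> 1"
        then have X: "\<gamma> t \<in> \<C>" "\<gamma> t \<in> mat_nbhd n \<epsilon>' M" using g(2) by auto
        then have "\<gamma> t \<in> carrier_mat n n" by (simp add: mat_nbhd_def)
        then show "(f P Q \<circ> \<gamma>) t \<in> \<C> \<inter> mat_nbhd n \<epsilon> N"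
          using closed[OF X(1) similar[OF w(6,7,1,2)]] e'(2) X(2) by auto
      qed (use g back_in(2)[OF A] back_in(2)[OF B] in auto)
    qed
    then show "\<exists>\<delta>>0. \<forall>A\<in>\<C> \<inter> mat_nbhd n \<delta> N. \<forall>B\<in>\<C> \<inter> mat_nbhd n \<delta> N. mpath n (\<C> \<inter> mat_nbhd n \<epsilon> N) A B"
      using d(1) by (intro exI[of _ \<delta>] conjI ballI)
  qed
qed

section \<open>Nilpotent Jordan matrices\<close>

text \<open>A nilpotent Jordan matrix with \<open>m\<close> blocks of sizes \<open>sz i\<close>, described by an enumeration \<open>loc\<close>
  of the pairs (block, position in the block), so that no arithmetic with block offsets is needed.
  The matrix lowers positions by one, so position 0 spans the kernel within its block and the
  last position generates the block.\<close>

locale jordan_index =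
  fixes n m :: nat and sz :: "nat \<Rightarrow> nat" and loc :: "nat \<Rightarrow> nat \<times> nat"
  assumes bij: "bij_betw loc {..<n} (SIGMA i:{..<m}. {..<sz i})"
begin

definition blk :: "nat \<Rightarrow> nat" where "blk b = fst (loc b)"
definition pos :: "nat \<Rightarrow> nat" where "pos b = snd (loc b)"
definition idx :: "nat \<Rightarrow> nat \<Rightarrow> nat" where "idx i k = inv_into {..<n} loc (i, k)"

definition J :: "real mat" where
  "J = mat n n (\<lambda>(a, b). if blk a = blk b \<and> pos b = Suc (pos a) then 1 else 0)"

lemma J_carrier [simp]: "J \<in> carrier_mat n n"
  by (simp add: J_def)

lemma J_dim [simp]: "dim_row J = n" "dim_col J = n"
  by (simp_all add: J_def)

lemma loc_range: "b < n \<Longrightarrow> blk b < m" "b < n \<Longrightarrow> pos b < sz (blk b)"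
  using bij_betw_apply[OF bij, of b] by (cases "loc b"; simp add: blk_def pos_def)+

lemma idx:
  assumes "i < m" "k < sz i"
  shows "idx i k < n" "blk (idx i k) = i" "pos (idx i k) = k"
proof -
  have "(i, k) \<in> loc ` {..<n}" using bij assms by (simp add: bij_betw_def)
  then show "idx i k < n" "blk (idx i k) = i" "pos (idx i k) = k"
    unfolding idx_def blk_def pos_def using inv_into_into[of "(i, k)" loc "{..<n}"]
    by (auto simp: f_inv_into_f)
qed

lemma idx_loc [simp]: "b < n \<Longrightarrow> idx (blk b) (pos b) = b"
  using bij by (simp add: idx_def blk_def pos_def bij_betw_def inv_into_f_f)

lemma col_J:
  assumes "b < n"
  shows "col J b = (if pos b = 0 then 0\<^sub>v n else unit_vec n (idx (blk b) (pos b - 1)))"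
proof (cases "pos b")
  case 0
  then show ?thesis using assms by (intro eq_vecI) (auto simp: J_def)
next
  case (Suc k)
  note r = idx[OF loc_range(1)[OF assms], of k]
  have "k < sz (blk b)" using loc_range(2)[OF assms] Suc by simp
  note r = r[OF this]
  have "blk a = blk b \<and> pos a = k \<longleftrightarrow> a = idx (blk b) k" if "a < n" for a
    using r idx_loc[OF that] by metis
  then show ?thesis using assms Suc r by (intro eq_vecI) (auto simp: J_def)
qed

lemma J_unit:
  assumes "i < m" "k < sz i"
  shows "J *\<^sub>v unit_vec n (idx i k) = (if k = 0 then 0\<^sub>v n else unit_vec n (idx i (k - 1)))"
  using idx[OF assms] by (simp add: mult_mat_unit_vec[of _ n] col_J)

lemma J_pow_unit:
  assumes "i < m" "k < sz i"
  shows "J ^\<^sub>m d *\<^sub>v unit_vec n (idx i k) = (if k < d then 0\<^sub>v n else unit_vec n (idx i (k - d)))"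
  using assms(2)
proof (induction d arbitrary: k)
  case 0
  then show ?case using idx[OF assms(1)] by simp
next
  case (Suc d)
  have "J ^\<^sub>m Suc d *\<^sub>v unit_vec n (idx i k) = J ^\<^sub>m d *\<^sub>v (J *\<^sub>v unit_vec n (idx i k))"
    by (rule pow_mat_Suc_vec[of _ n]) auto
  moreover have "J *\<^sub>v unit_vec n (idx i k) = (if k = 0 then 0\<^sub>v n else unit_vec n (idx i (k - 1)))"
    by (rule J_unit[OF assms(1) Suc.prems])
  moreover have "J ^\<^sub>m d *\<^sub>v 0\<^sub>v n = 0\<^sub>v n" by (intro eq_vecI) auto
  ultimately show ?case
    using Suc by (cases k) auto
qed

lemma J_pow_zero:
  assumes "\<And>i. i < m \<Longrightarrow> sz i \<le> h"
  shows "J ^\<^sub>m h = 0\<^sub>m n n"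
proof (rule mat_eq_by_cols)
  fix b assume b: "b < n"
  have "col (J ^\<^sub>m h) b = J ^\<^sub>m h *\<^sub>v unit_vec n (idx (blk b) (pos b))"
    using b by (simp add: mult_mat_unit_vec)
  also have "\<dots> = 0\<^sub>v n"
    using J_pow_unit[OF loc_range(1)[OF b] loc_range(2)[OF b], of h] loc_range[OF b] assms[of "blk b"]
    by simp
  finally show "col (J ^\<^sub>m h) b = col (0\<^sub>m n n) b" using b by simp
qed auto

text \<open>Nilpotent conjugacy classes are cones: the powers of \<open>t\<close> indexed by the position absorb a
  factor \<open>t\<close>.\<close>

lemma smult_J_similar:
  assumes "t \<noteq> 0"
  shows "similar_mat (t \<cdot>\<^sub>m J) J"
proof -
  have "t \<cdot>\<^sub>m J = mat n n (\<lambda>(a, b). (1 / t) ^ pos a * J $$ (a, b) / (1 / t) ^ pos b)"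
    using assms by (intro eq_matI) (auto simp: J_def power_divide)
  then show ?thesis
    using diagonal_rescaling_similar[OF J_carrier, of "\<lambda>a. (1 / t) ^ pos a"] assms by simp
qed

text \<open>The sign change on a zero block centralises the matrix and has determinant \<open>-1\<close>. It is the
  reason why orientation is no obstruction in the main argument.\<close>

lemma flip_zero_block:
  assumes "z < m" "sz z = 1"
  shows "multrow_mat n (idx z 0) (-1) * J = J * multrow_mat n (idx z 0) (-1)"
proof -
  let ?z = "idx z 0"
  have z: "?z < n" "blk ?z = z" "pos ?z = 0" using idx[OF assms(1)] assms(2) by auto
  have "J $$ (?z, b) = 0" if "b < n" for b
    using z loc_range[OF that] assms(2) that by (auto simp: J_def)
  moreover have "J $$ (a, ?z) = 0" if "a < n" for a
    using z that by (auto simp: J_def)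
  moreover have "multrow_mat n ?z (-1) * J = multrow ?z (-1) J"
    by (rule multrow_mat[symmetric, of _ n n]) simp
  moreover have "J * multrow_mat n ?z (-1) = multcol ?z (-1) J"
    by (rule multcol_mat[symmetric, of _ n n]) simp
  ultimately show ?thesis
    using carrier_matD[OF J_carrier] by (intro eq_matI) auto
qed

end


text \<open>The enumeration of block positions for which \<open>jordan_index.J\<close> is the Jordan matrix with the
  given block sizes.\<close>

fun block_loc :: "nat list \<Rightarrow> nat \<Rightarrow> nat \<times> nat" where
  "block_loc [] b = (0, b)"
| "block_loc (k # ks) b =
    (if b < k then (0, b) else (Suc (fst (block_loc ks (b - k))), snd (block_loc ks (b - k))))"

lemma block_loc_offset:
  assumes "b < sum_list ks"
  shows "fst (block_loc ks b) < length ks \<and> snd (block_loc ks b) < ks ! fst (block_loc ks b) \<and>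
    sum_list (take (fst (block_loc ks b)) ks) + snd (block_loc ks b) = b"
  using assms
proof (induction ks arbitrary: b)
  case (Cons k ks)
  show ?case
  proof (cases "b < k")
    case False
    then have "b - k < sum_list ks" using Cons.prems by auto
    from Cons.IH[OF this] False show ?thesis by (simp, linarith)
  qed simp
qed simp

lemma block_loc_inverse:
  assumes "i < length ks" "k < ks ! i"
  shows "block_loc ks (sum_list (take i ks) + k) = (i, k) \<and> sum_list (take i ks) + k < sum_list ks"
  using assms
proof (induction ks arbitrary: i)
  case (Cons l ks)
  show ?case
  proof (cases i)
    case (Suc i')
    then have "block_loc ks (sum_list (take i' ks) + k) = (i', k)"
      "sum_list (take i' ks) + k < sum_list ks"
      using Cons.IH[of i'] Cons.prems by auto
    then show ?thesis using Suc by (simp add: add.assoc)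
  qed (use Cons.prems in simp)
qed simp

lemma bij_betw_block_loc:
  "bij_betw (block_loc ks) {..<sum_list ks} (SIGMA i:{..<length ks}. {..<ks ! i})"
proof (rule bij_betw_byWitness[where f' = "\<lambda>(i, k). sum_list (take i ks) + k"])
  show "\<forall>b\<in>{..<sum_list ks}. (case block_loc ks b of (i, k) \<Rightarrow> sum_list (take i ks) + k) = b"
    using block_loc_offset by (auto simp: case_prod_beta)
  show "\<forall>p\<in>SIGMA i:{..<length ks}. {..<ks ! i}.
      block_loc ks (case p of (i, k) \<Rightarrow> sum_list (take i ks) + k) = p"
    using block_loc_inverse by auto
  show "block_loc ks ` {..<sum_list ks} \<subseteq> (SIGMA i:{..<length ks}. {..<ks ! i})"
  proof (rule image_subsetI)
    fix b assume "b \<in> {..<sum_list ks}"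
    then show "block_loc ks b \<in> (SIGMA i:{..<length ks}. {..<ks ! i})"
      using block_loc_offset[of b ks] by (cases "block_loc ks b") simp
  qed
  show "(\<lambda>(i, k). sum_list (take i ks) + k) ` (SIGMA i:{..<length ks}. {..<ks ! i}) \<subseteq> {..<sum_list ks}"
    using block_loc_inverse by auto
qed

lemma jordan_matrix_entry:
  fixes bs :: "(nat \<times> real) list"
  assumes "snd ` set bs \<subseteq> {0}" and "i < sum_list (map fst bs)" and "j < sum_list (map fst bs)"
  shows "jordan_matrix bs $$ (i, j) =
    (let l = block_loc (map fst bs)
     in if fst (l i) = fst (l j) \<and> snd (l j) = Suc (snd (l i)) then 1 else 0)"
  using assms
proof (induction bs arbitrary: i j)
  case (Cons p bs)
  obtain k where p: "p = (k, 0)" using Cons.prems(1) by (cases p) auto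
  let ?S = "sum_list (map fst bs)"
  have "jordan_matrix (p # bs) = four_block_mat (jordan_block k 0)
      (0\<^sub>m (dim_row (jordan_block k (0 :: real))) (dim_col (jordan_matrix bs)))
      (0\<^sub>m (dim_row (jordan_matrix bs)) (dim_col (jordan_block k (0 :: real)))) (jordan_matrix bs)"
    by (simp only: p jordan_matrix_def list.map prod.case diag_block_mat.simps Let_def)
  then have "jordan_matrix (p # bs) $$ (i, j) =
      (if i < k then if j < k then jordan_block k 0 $$ (i, j) else 0
       else if j < k then 0 else jordan_matrix bs $$ (i - k, j - k))"
    using Cons.prems by (auto simp: p)
  then show ?case
    using Cons.IH[of "i - k" "j - k"] Cons.prems by (auto simp: p Let_def)
qed simp

lemma jordan_matrix_eq_J:
  fixes bs :: "(nat \<times> real) list"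
  assumes "snd ` set bs \<subseteq> {0}" and "n = sum_list (map fst bs)"
  shows "jordan_index n (length bs) (\<lambda>i. fst (bs ! i)) (block_loc (map fst bs))"
    and "jordan_matrix bs = jordan_index.J n (block_loc (map fst bs))"
proof -
  have "(SIGMA i:{..<length bs}. {..<map fst bs ! i}) = (SIGMA i:{..<length bs}. {..<fst (bs ! i)})"
    by auto
  then show I: "jordan_index n (length bs) (\<lambda>i. fst (bs ! i)) (block_loc (map fst bs))"
    using bij_betw_block_loc[of "map fst bs"] assms(2) by unfold_locales simp
  show "jordan_matrix bs = jordan_index.J n (block_loc (map fst bs))"
    unfolding jordan_index.J_def[OF I] jordan_index.blk_def[OF I] jordan_index.pos_def[OF I]
    using jordan_matrix_entry[OF assms(1)] assms(2)
    by (intro eq_matI) (auto simp: Let_def)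
qed

lemma nilpotent_jordan_nf_eigenvalues:
  assumes A: "A \<in> carrier_mat n n" and nil: "nilpotent_mat A" and nf: "jordan_nf A bs"
  shows "snd ` set bs \<subseteq> {0}"
proof
  fix a assume "a \<in> snd ` set bs"
  then obtain k where k: "(k, a) \<in> set bs" by force
  then have "k \<noteq> 0" using nf by (force simp: jordan_nf_def)
  have "poly (\<Prod>(k, a)\<leftarrow>cs. [:- a, 1:] ^ k) a = 0" if "(k, a) \<in> set cs" for cs
    using that \<open>k \<noteq> 0\<close> by (induction cs) (auto simp: power_eq_0_iff)
  then have "poly (char_poly A) a = 0"
    unfolding jordan_nf_char_poly[OF nf] using k by blast
  then have "eigenvalue A a" using eigenvalue_root_char_poly[OF A] by simp
  then obtain v where v: "eigenvector A v a" by (auto simp: eigenvalue_def)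
  obtain d where d: "A ^\<^sub>m d = 0\<^sub>m n n" using nil A by (auto simp: nilpotent_mat_def)
  have vc: "v \<in> carrier_vec n" "v \<noteq> 0\<^sub>v n" using v A by (auto simp: eigenvector_def)
  have "a ^ d \<cdot>\<^sub>v v = 0\<^sub>m n n *\<^sub>v v"
    unfolding d[symmetric] by (rule eigenvector_pow[OF A v, symmetric])
  also have "\<dots> = 0\<^sub>v n" using vc(1) by (intro eq_vecI) auto
  finally have z: "a ^ d \<cdot>\<^sub>v v = 0\<^sub>v n" .
  have "\<exists>i<n. vec_index v i \<noteq> 0"
  proof (rule ccontr)
    assume "\<not> ?thesis"
    then have "v = 0\<^sub>v n" using vc(1) by (intro eq_vecI) auto
    then show False using vc(2) by simp
  qed
  then obtain i where i: "i < n" "vec_index v i \<noteq> 0" by blast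
  have "a ^ d * vec_index v i = 0"
    using arg_cong[OF z, of "\<lambda>w. vec_index w i"] i vc by simp
  then show "a \<in> {0}" using i by simp
qed

section \<open>Local connectedness at a Jordan matrix\<close>

lemma openin_prod_mat_nbhdE:
  assumes "openin (prod_topology (mat_topology n) (mat_topology n)) S" "(A, B) \<in> S"
  obtains r where "r > 0" "mat_nbhd n r A \<times> mat_nbhd n r B \<subseteq> S"
proof -
  obtain U V where U: "openin (mat_topology n) U" "A \<in> U" and V: "openin (mat_topology n) V" "B \<in> V"
    and UV: "U \<times> V \<subseteq> S"
    using assms unfolding openin_prod_topology_alt by blast
  obtain r s where rs: "r > 0" "mat_nbhd n r A \<subseteq> U" "s > 0" "mat_nbhd n s B \<subseteq> V"
    using openin_mat_topologyD[OF U] openin_mat_topologyD[OF V] by metis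
  have "mat_nbhd n (min r s) A \<subseteq> U" "mat_nbhd n (min r s) B \<subseteq> V"
    using rs by (auto simp: mat_nbhd_def)
  then show ?thesis using that[of "min r s"] rs UV by (meson Sigma_mono min_less_iff_conj order_trans)
qed

text \<open>\<open>N.J\<close> is the matrix at which local connectedness is studied and \<open>C.J\<close> represents the class.
  The injection \<open>\<tau>\<close> assigns to every block of \<open>N.J\<close> of size at least 2 its own block of \<open>C.J\<close> of
  maximal size \<open>h\<close>, and \<open>z\<close> is a zero block of \<open>C.J\<close>.\<close>

locale jordan_pair = N: jordan_index n mN szN locN + C: jordan_index n mC szC locC
  for n mN szN locN mC szC locC +
  fixes h :: nat and \<tau> :: "nat \<Rightarrow> nat" and z :: nat
  assumes szN_le: "\<And>i. i < mN \<Longrightarrow> szN i \<le> h"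
    and szC_le: "\<And>i. i < mC \<Longrightarrow> szC i \<le> h"
    and \<tau>_inj: "inj_on \<tau> {i. i < mN \<and> 2 \<le> szN i}"
    and \<tau>_top: "\<And>i. i < mN \<Longrightarrow> 2 \<le> szN i \<Longrightarrow> \<tau> i < mC \<and> szC (\<tau> i) = h"
    and zero_block: "z < mC" "szC z = 1"
begin

definition big :: "nat set" where "big = {i. i < mN \<and> 2 \<le> szN i}"
definition depth :: "nat \<Rightarrow> nat" where "depth b = szN (N.blk b) - 1 - N.pos b"
definition gen :: "nat \<Rightarrow> nat" where "gen i = N.idx i (szN i - 1)"
definition apex :: "nat \<Rightarrow> nat" where "apex i = C.idx (\<tau> i) (h - 1)"
definition target :: "nat \<Rightarrow> nat" where "target b = C.idx (\<tau> (N.blk b)) (h - 1 - depth b)"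

text \<open>The basis vector with index \<open>b\<close> arises from the generator of its block by applying \<open>N.J\<close>
  \<open>depth b\<close> times. Doing the same with \<open>A\<close>, starting from the columns of \<open>W\<close>, gives the chain frame.
  If \<open>A\<close> is near \<open>N.J\<close> and \<open>W\<close> near the identity then it is near the identity, and by construction
  its columns within a block are linked by \<open>A\<close>.\<close>

definition chain_frame :: "real mat \<Rightarrow> real mat \<Rightarrow> real mat" where
  "chain_frame A W = mat n n (\<lambda>(a, b). (A ^\<^sub>m depth b * W) $$ (a, gen (N.blk b)))"

lemma chain_frame_carrier [simp]: "chain_frame A W \<in> carrier_mat n n"
  by (simp add: chain_frame_def)

lemma gen_less: "i < mN \<Longrightarrow> 0 < szN i \<Longrightarrow> gen i < n"
  unfolding gen_def by (rule N.idx) auto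

lemma gen_blk_less: "b < n \<Longrightarrow> gen (N.blk b) < n"
  using N.loc_range[of b] by (intro gen_less) auto

lemma col_chain_frame:
  assumes "A \<in> carrier_mat n n" "W \<in> carrier_mat n n" "b < n"
  shows "col (chain_frame A W) b = A ^\<^sub>m depth b *\<^sub>v col W (gen (N.blk b))"
proof -
  have "col (chain_frame A W) b = col (A ^\<^sub>m depth b * W) (gen (N.blk b))"
    using assms gen_blk_less[OF assms(3)]
    by (intro eq_vecI) (auto simp: chain_frame_def)
  also have "\<dots> = A ^\<^sub>m depth b *\<^sub>v col W (gen (N.blk b))"
    by (rule col_mult2[of _ n n _ n]) (use assms gen_blk_less in auto)
  finally show ?thesis .
qed

lemma chain_frame_base: "chain_frame N.J (1\<^sub>m n) = 1\<^sub>m n"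
proof (rule mat_eq_by_cols)
  fix b assume b: "b < n"
  note r = N.loc_range[OF b]
  have "col (chain_frame N.J (1\<^sub>m n)) b = N.J ^\<^sub>m depth b *\<^sub>v unit_vec n (gen (N.blk b))"
    using b gen_blk_less[OF b] by (simp add: col_chain_frame)
  also have "\<dots> = unit_vec n (N.idx (N.blk b) (szN (N.blk b) - 1 - depth b))"
    unfolding gen_def using r by (subst N.J_pow_unit) (auto simp: depth_def)
  also have "szN (N.blk b) - 1 - depth b = N.pos b"
    using r by (simp add: depth_def)
  finally show "col (chain_frame N.J (1\<^sub>m n)) b = col (1\<^sub>m n) b"
    using b by simp
qed auto

lemma chain_frame_near:
  assumes "r > 0"
  obtains \<rho> where "\<rho> > 0" "\<And>A W. A \<in> mat_nbhd n \<rho> N.J \<Longrightarrow> W \<in> mat_nbhd n \<rho> (1\<^sub>m n) \<Longrightarrow>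
    chain_frame A W \<in> mat_nbhd n r (1\<^sub>m n)"
proof -
  let ?M = "mat_topology n"
  let ?X = "prod_topology ?M ?M"
  have "continuous_map ?X ?M (\<lambda>x. fst x ^\<^sub>m depth b * snd x)" for b
    by (intro continuous_map_mat_mult continuous_map_mat_pow continuous_map_fst continuous_map_snd)
  then have "continuous_map ?X euclideanreal (\<lambda>x. (fst x ^\<^sub>m depth b * snd x) $$ (a, gen (N.blk b)))"
    if "a < n" "b < n" for a b
    using that gen_blk_less by (intro continuous_map_matD(2))
  then have "continuous_map ?X ?M (\<lambda>x. chain_frame (fst x) (snd x))"
    by (auto simp: continuous_map_mat_iff chain_frame_def)
  then have "openin ?X {x \<in> topspace ?X. chain_frame (fst x) (snd x) \<in> mat_nbhd n r (1\<^sub>m n)}"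
    by (rule openin_continuous_map_preimage) (rule openin_mat_nbhd, simp)
  then obtain \<rho> where "\<rho> > 0" "mat_nbhd n \<rho> N.J \<times> mat_nbhd n \<rho> (1\<^sub>m n)
      \<subseteq> {x \<in> topspace ?X. chain_frame (fst x) (snd x) \<in> mat_nbhd n r (1\<^sub>m n)}"
    by (rule openin_prod_mat_nbhdE[of _ _ N.J "1\<^sub>m n"])
      (use assms chain_frame_base in \<open>auto simp: mat_nbhd_iff\<close>)
  then show thesis using that[of \<rho>] by (auto simp: subset_iff)
qed

lemma h_ge_2: "i \<in> big \<Longrightarrow> 2 \<le> h"
  using szN_le[of i] by (auto simp: big_def)

lemma apex_less: "i \<in> big \<Longrightarrow> apex i < n"
  unfolding apex_def using \<tau>_top[of i] h_ge_2[of i] by (intro C.idx) (auto simp: big_def)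

text \<open>Every vector generates a chain of length at most \<open>h\<close> under \<open>C.J\<close>, so the generators of blocks of
  size \<open>h\<close> can be sent to arbitrary vectors by a matrix that commutes with \<open>C.J\<close>. This is where
  maximality of the chosen blocks enters.\<close>

lemma commuting_chains:
  assumes P: "P \<in> carrier_mat n n"
  obtains Z where "Z \<in> carrier_mat n n" "Z * C.J = C.J * Z"
    "\<And>i. i \<in> big \<Longrightarrow> Z *\<^sub>v unit_vec n (apex i) = col P (gen i)"
proof -
  define src where "src = inv_into big \<tau>"
  have src: "src (\<tau> i) = i" if "i \<in> big" for i
    using \<tau>_inj that unfolding src_def big_def by (intro inv_into_f_f)
  have src_big: "src j \<in> big" if "j \<in> \<tau> ` big" for j
    using inv_into_into[OF that] by (simp add: src_def)
  have gen_n: "gen (src j) < n" if "j \<in> \<tau> ` big" for j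
    using src_big[OF that] by (intro gen_less) (auto simp: big_def)
  define w where "w b = (if C.blk b \<in> \<tau> ` big
      then C.J ^\<^sub>m (h - 1 - C.pos b) *\<^sub>v col P (gen (src (C.blk b))) else 0\<^sub>v n)" for b
  have w: "w b \<in> carrier_vec n" for b
    using P by (auto simp: w_def intro!: mult_mat_vec_carrier[of _ n n])
  define Z where "Z = mat n n (\<lambda>(a, b). vec_index (w b) a)"
  have Z: "Z \<in> carrier_mat n n" by (simp add: Z_def)
  have colZ: "col Z b = w b" if "b < n" for b
    using that w[of b] by (intro eq_vecI) (auto simp: Z_def)
  have J0: "C.J *\<^sub>v 0\<^sub>v n = 0\<^sub>v n" "Z *\<^sub>v 0\<^sub>v n = 0\<^sub>v n"
    using Z by (auto intro!: eq_vecI)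
  show thesis
  proof (rule that[OF Z])
    show "Z * C.J = C.J * Z"
    proof (rule mat_eq_by_cols)
      fix b assume b: "b < n"
      note r = C.loc_range[OF b]
      have l: "col (Z * C.J) b = Z *\<^sub>v col C.J b" by (rule col_mult2) (use Z b in auto)
      have rr: "col (C.J * Z) b = C.J *\<^sub>v w b"
        using col_mult2[OF C.J_carrier Z b] colZ[OF b] by simp
      have step: "C.J *\<^sub>v (C.J ^\<^sub>m d *\<^sub>v v) = C.J ^\<^sub>m Suc d *\<^sub>v v" if "v \<in> carrier_vec n" for d v
      proof -
        have "C.J ^\<^sub>m Suc d = C.J * C.J ^\<^sub>m d"
          using pow_mat_intertwine[of C.J n C.J C.J d] by simp
        moreover have "C.J * C.J ^\<^sub>m d *\<^sub>v v = C.J *\<^sub>v (C.J ^\<^sub>m d *\<^sub>v v)"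
          by (rule assoc_mult_mat_vec[of _ n n _ n]) (use that in auto)
        ultimately show ?thesis by simp
      qed
      show "col (Z * C.J) b = col (C.J * Z) b"
      proof (cases "C.blk b \<in> \<tau> ` big")
        case False
        show ?thesis
        proof (cases "C.pos b = 0")
          case True
          then show ?thesis using l rr C.col_J[OF b] J0 False by (simp add: w_def)
        next
          case pos: False
          have "C.blk (C.idx (C.blk b) (C.pos b - 1)) = C.blk b" "C.idx (C.blk b) (C.pos b - 1) < n"
            using C.idx[of "C.blk b" "C.pos b - 1"] r by auto
          then show ?thesis using l rr C.col_J[OF b] J0 False pos colZ Z
            by (simp add: mult_mat_unit_vec w_def)
        qed
      next
        case big: True
        let ?x = "col P (gen (src (C.blk b)))"
        have x: "?x \<in> carrier_vec n" using P gen_n[OF big] by auto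
        have hb: "C.pos b < h" using r szC_le[of "C.blk b"] by auto
        have "C.J *\<^sub>v w b = C.J ^\<^sub>m (h - C.pos b) *\<^sub>v ?x"
          using step[OF x, of "h - 1 - C.pos b"] big hb by (simp add: w_def Suc_diff_Suc)
        moreover have "Z *\<^sub>v col C.J b = C.J ^\<^sub>m (h - C.pos b) *\<^sub>v ?x"
        proof (cases "C.pos b = 0")
          case True
          have "0\<^sub>m n n *\<^sub>v ?x = 0\<^sub>v n" using x by (intro eq_vecI) auto
          then show ?thesis
            using True C.J_pow_zero[OF szC_le] C.col_J[OF b] J0 by simp
        next
          case pos: False
          let ?b = "C.idx (C.blk b) (C.pos b - 1)"
          have "C.blk ?b = C.blk b" "C.pos ?b = C.pos b - 1" "?b < n"
            using C.idx[of "C.blk b" "C.pos b - 1"] r by auto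
          then show ?thesis using C.col_J[OF b] pos colZ Z big hb
            by (simp add: mult_mat_unit_vec w_def)
        qed
        ultimately show ?thesis using l rr by simp
      qed
    qed (use Z in auto)
    fix i assume i: "i \<in> big"
    have t: "C.blk (apex i) = \<tau> i" "C.pos (apex i) = h - 1" "apex i < n"
      unfolding apex_def using C.idx[of "\<tau> i" "h - 1"] \<tau>_top[of i] h_ge_2[OF i] i
      by (auto simp: big_def)
    have "col P (gen i) \<in> carrier_vec n" using P gen_less[of i] i by (auto simp: big_def)
    then show "Z *\<^sub>v unit_vec n (apex i) = col P (gen i)"
      using t i src[OF i] colZ[OF t(3)] Z by (simp add: mult_mat_unit_vec w_def)
  qed
qed


text \<open>The matrix just constructed may be singular, but adding \<open>\<eta>\<close> times the identity makes it
  invertible for all but finitely many \<open>\<eta>\<close>, and it still commutes with \<open>C.J\<close>. The effect on the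
  prescribed vectors is matched by a perturbation of the identity of size \<open>\<eta>\<close>. This replaces the
  argument that a generic tuple of vectors near the generators of \<open>N.J\<close> generates a free direct
  summand of maximal height.\<close>

lemma generic_commutant:
  assumes sim: "similar_mat_wit A C.J Q P" and A: "A \<in> carrier_mat n n" and r: "r > 0"
  obtains W c where "W \<in> mat_nbhd n r (1\<^sub>m n)" "c \<in> carrier_mat n n" "det c \<noteq> 0"
    "c * C.J = C.J * c" "\<And>i. i \<in> big \<Longrightarrow> P *\<^sub>v col W (gen i) = c *\<^sub>v unit_vec n (apex i)"
proof -
  note w = similar_mat_witD2[OF A sim]
  have Q: "Q \<in> carrier_mat n n" and P: "P \<in> carrier_mat n n" and PQ: "P * Q = 1\<^sub>m n" using w by auto
  obtain Z where Z: "Z \<in> carrier_mat n n" "Z * C.J = C.J * Z"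
    "\<And>i. i \<in> big \<Longrightarrow> Z *\<^sub>v unit_vec n (apex i) = col P (gen i)"
    using commuting_chains[OF P] by blast
  define K where "K = mat n n (\<lambda>(a, b). if a = apex (N.blk b) then 1 else 0 :: real)"
  have K: "K \<in> carrier_mat n n" by (simp add: K_def)
  define X where "X = Q * K"
  have X: "X \<in> carrier_mat n n" using Q K by (simp add: X_def)
  define B where "B = max_norm X + 1"
  have B0: "B > 0" and B: "\<bar>X $$ (i, j)\<bar> < B" if "i < n" "j < n" for i j
  proof -
    have "max_norm X \<le> max_norm X" by simp
    then have "0 \<le> max_norm X \<and> (\<forall>i<n. \<forall>j<n. \<bar>X $$ (i, j)\<bar> \<le> max_norm X)"
      by (subst (asm) max_norm_le_iff[OF X])
    then show "B > 0" "\<bar>X $$ (i, j)\<bar> < B" using that by (force simp: B_def)+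
  qed
  have "finite {x. poly (char_poly Z) x = 0}"
    using degree_monic_char_poly[OF Z(1)] by (intro poly_roots_finite) auto
  moreover have "infinite {0<..<r / (\<bar>B\<bar> + 1)}"
    using r by (intro infinite_Ioo) auto
  ultimately obtain \<eta> where eta: "0 < \<eta>" "\<eta> < r / (\<bar>B\<bar> + 1)" "poly (char_poly Z) (- \<eta>) \<noteq> 0"
  proof -
    assume fin: "finite {x. poly (char_poly Z) x = 0}" and inf: "infinite {0<..<r / (\<bar>B\<bar> + 1)}"
      and th: "\<And>\<eta>. 0 < \<eta> \<Longrightarrow> \<eta> < r / (\<bar>B\<bar> + 1) \<Longrightarrow> poly (char_poly Z) (- \<eta>) \<noteq> 0 \<Longrightarrow> thesis"
    have "finite (uminus ` {x. poly (char_poly Z) x = 0})" using fin by simp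
    then have "\<not> {0<..<r / (\<bar>B\<bar> + 1)} \<subseteq> uminus ` {x. poly (char_poly Z) x = 0}"
      using inf finite_subset by blast
    then obtain \<eta> where "\<eta> \<in> {0<..<r / (\<bar>B\<bar> + 1)}" "\<eta> \<notin> uminus ` {x. poly (char_poly Z) x = 0}" by blast
    then show thesis using th[of \<eta>] by (force simp: image_iff)
  qed
  define c where "c = Z + \<eta> \<cdot>\<^sub>m 1\<^sub>m n"
  define W where "W = 1\<^sub>m n + \<eta> \<cdot>\<^sub>m X"
  have c: "c \<in> carrier_mat n n" and W: "W \<in> carrier_mat n n"
    using Z X by (auto simp: c_def W_def)
  show thesis
  proof (rule that)
    have "\<bar>\<eta> * X $$ (i, j)\<bar> < r" if "i < n" "j < n" for i j
    proof -
      have "\<bar>\<eta> * X $$ (i, j)\<bar> \<le> \<eta> * (\<bar>B\<bar> + 1)"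
        using B[OF that] eta(1) by (auto simp: abs_mult intro!: mult_left_mono)
      also have "\<dots> < r" using eta(2) by (simp add: pos_less_divide_eq)
      finally show ?thesis .
    qed
    moreover have "W $$ (i, j) - 1\<^sub>m n $$ (i, j) = \<eta> * X $$ (i, j)" if "i < n" "j < n" for i j
      using that X by (simp add: W_def)
    ultimately have "\<forall>i<n. \<forall>j<n. \<bar>W $$ (i, j) - 1\<^sub>m n $$ (i, j)\<bar> < r" by metis
    then show "W \<in> mat_nbhd n r (1\<^sub>m n)"
      using mat_nbhd_iff[of "1\<^sub>m n" n W r] W r by simp
    show "c \<in> carrier_mat n n" by (rule c)
    have "c = char_matrix Z (- \<eta>)"
      using Z(1) by (simp add: c_def char_matrix_def)
    moreover have "det (char_matrix Z (- \<eta>)) \<noteq> 0"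
      using eta(3) eigenvalue_root_char_poly[OF Z(1)] eigenvalue_det[OF Z(1)] by simp
    ultimately show "det c \<noteq> 0" by simp
    show "c * C.J = C.J * c"
      unfolding c_def using Z
      by (simp add: add_mult_distrib_mat[of _ n n _ _ n] mult_add_distrib_mat[of _ n n _ n]
          mult_smult_assoc_mat[of _ n n _ n] mult_smult_distrib[of _ n n _ n])
    fix i assume i: "i \<in> big"
    have g: "gen i < n" "N.blk (gen i) = i"
      using i N.idx[of i "szN i - 1"] by (auto simp: big_def gen_def)
    note a = apex_less[OF i]
    have "col K (gen i) = unit_vec n (apex i)"
      using g a by (intro eq_vecI) (auto simp: K_def)
    then have "col (P * X) (gen i) = unit_vec n (apex i)"
      using assoc_mult_mat[OF P Q K] PQ K by (simp add: X_def)
    moreover have "P * W = P + \<eta> \<cdot>\<^sub>m (P * X)"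
      unfolding W_def using P X by (simp add: mult_add_distrib_mat[of _ n n _ n] mult_smult_distrib[of _ n n _ n])
    moreover have "P * X \<in> carrier_mat n n" using P X by simp
    ultimately have "col (P * W) (gen i) = col P (gen i) + \<eta> \<cdot>\<^sub>v unit_vec n (apex i)"
      using P g carrier_matD(2)[OF X] by (simp del: col_mult2)
    moreover have "col (P * W) (gen i) = P *\<^sub>v col W (gen i)"
      by (rule col_mult2[OF P W g(1)])
    moreover have "c *\<^sub>v unit_vec n (apex i) = col P (gen i) + \<eta> \<cdot>\<^sub>v unit_vec n (apex i)"
      using Z(1) Z(3)[OF i] mult_mat_unit_vec[OF Z(1) a] mult_mat_unit_vec[OF c a] a
      by (simp add: c_def)
    ultimately show "P *\<^sub>v col W (gen i) = c *\<^sub>v unit_vec n (apex i)" by simp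
  qed
qed


lemma target:
  assumes "b < n" "N.blk b \<in> big"
  shows "target b < n" "C.blk (target b) = \<tau> (N.blk b)" "C.pos (target b) = h - 1 - depth b"
  unfolding target_def using C.idx[of "\<tau> (N.blk b)" "h - 1 - depth b"] \<tau>_top[of "N.blk b"]
    h_ge_2[OF assms(2)] assms by (auto simp: big_def)

text \<open>After conjugation by a chain frame near the identity, an element of the class is
  \<open>minv M * C.J * M\<close> with \<open>M\<close> of positive determinant whose columns on the large blocks do not depend
  on the element. The commuting matrix of the previous lemma standardises those columns, and the
  sign of a zero block of \<open>C.J\<close> corrects the orientation.\<close>

lemma normal_form:
  assumes A: "A \<in> carrier_mat n n" "similar_mat A C.J" and r: "r > 0"
  obtains W where "W \<in> mat_nbhd n r (1\<^sub>m n)"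
    "det (chain_frame A W) \<noteq> 0 \<Longrightarrow> \<exists>M \<in> carrier_mat n n. det M > 0 \<and>
       (\<forall>b<n. N.blk b \<in> big \<longrightarrow> col M b = unit_vec n (target b)) \<and>
       minv (chain_frame A W) * A * chain_frame A W = minv M * C.J * M"
proof -
  obtain Q P where sim: "similar_mat_wit A C.J Q P" using A(2) by (auto simp: similar_mat_def)
  note w = similar_mat_witD2[OF A(1) sim]
  have Q: "Q \<in> carrier_mat n n" and P: "P \<in> carrier_mat n n" and PQ: "P * Q = 1\<^sub>m n"
    using w by auto
  note AQ = w(3)
  have "P * A = P * (Q * (C.J * P))" by (simp only: AQ assoc_mult_mat[OF Q C.J_carrier P])
  also have "\<dots> = P * Q * (C.J * P)"
    by (rule assoc_mult_mat[symmetric]) (use P Q in auto)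
  finally have PA: "P * A = C.J * P" using PQ P by simp
  have dP: "det P \<noteq> 0" using det_mult[OF P Q] PQ by auto
  obtain W c where W: "W \<in> mat_nbhd n r (1\<^sub>m n)" and c: "c \<in> carrier_mat n n" "det c \<noteq> 0"
    "c * C.J = C.J * c" and Wc: "\<And>i. i \<in> big \<Longrightarrow> P *\<^sub>v col W (gen i) = c *\<^sub>v unit_vec n (apex i)"
    using generic_commutant[OF sim A(1) r] by blast
  have Wn: "W \<in> carrier_mat n n" using W by (simp add: mat_nbhd_def)
  note ci = minv[OF c(1)]
  let ?G = "chain_frame A W"
  have k: "minv c * C.J \<in> carrier_mat n n"
    by (rule mult_carrier_mat[OF ci(1) C.J_carrier])
  have "minv c * C.J = minv c * C.J * (c * minv c)"
    using ci(3)[OF c(2)] right_mult_one_mat[OF k] by simp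
  also have "\<dots> = minv c * (C.J * c) * minv c"
    by (simp only: assoc_mult_mat[OF k c(1) ci(1), symmetric] assoc_mult_mat[OF ci(1) C.J_carrier c(1)])
  also have "minv c * (C.J * c) = minv c * c * C.J"
    by (simp only: c(3)[symmetric] assoc_mult_mat[OF ci(1) c(1) C.J_carrier])
  finally have cJ: "minv c * C.J = C.J * minv c"
    using ci(2)[OF c(2)] by simp
  show thesis
  proof (rule that[OF W])
    assume dG: "det ?G \<noteq> 0"
    note Gi = minv[OF chain_frame_carrier[of A W]]
    define X where "X = minv ?G * A * ?G"
    have X: "X \<in> carrier_mat n n" unfolding X_def by (intro mult_carrier_mat[of _ n n] Gi(1) A(1) chain_frame_carrier)
    define M where "M = minv c * P * ?G"
    have M: "M \<in> carrier_mat n n" unfolding M_def by (intro mult_carrier_mat[of _ n n] ci(1) P chain_frame_carrier)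
    have "det (minv c) \<noteq> 0" using det_mult[OF ci(1) c(1)] ci(2)[OF c(2)] by auto
    then have dM: "det M \<noteq> 0"
      using dP dG det_mult[OF mult_carrier_mat[OF ci(1) P] chain_frame_carrier[of A W]] det_mult[OF ci(1) P]
      by (simp add: M_def)
    have "M * X = minv c * P * (?G * (minv ?G * A * ?G))"
      unfolding M_def X_def by (rule assoc_mult_mat) (use ci(1) P Gi(1) A in auto)
    also have "?G * (minv ?G * A * ?G) = ?G * minv ?G * (A * ?G)"
      using Gi(1) A by (simp add: assoc_mult_mat[of _ n n _ n _ n])
    also have "\<dots> = A * ?G" using Gi(3)[OF dG] A by simp
    also have "minv c * P * (A * ?G) = minv c * (P * A) * ?G"
      using ci(1) P A by (simp add: assoc_mult_mat[of _ n n _ n _ n])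
    also have "\<dots> = (minv c * C.J) * P * ?G"
      unfolding PA using ci(1) P by (simp add: assoc_mult_mat[of _ n n _ n _ n])
    also have "\<dots> = C.J * M"
      unfolding cJ M_def using ci(1) P by (simp add: assoc_mult_mat[of _ n n _ n _ n])
    finally have MX: "M * X = C.J * M" .
    have colM: "col M b = unit_vec n (target b)" if b: "b < n" "N.blk b \<in> big" for b
    proof -
      let ?d = "depth b" and ?g = "gen (N.blk b)" and ?e = "unit_vec n (apex (N.blk b))"
      have g: "?g < n" by (rule gen_blk_less[OF b(1)])
      have cw: "col W ?g \<in> carrier_vec n" using Wn g by auto
      have Ad: "A ^\<^sub>m ?d \<in> carrier_mat n n" using A by simp
      have "col M b = minv c * P *\<^sub>v (A ^\<^sub>m ?d *\<^sub>v col W ?g)"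
        unfolding M_def col_mult2[OF mult_carrier_mat[OF ci(1) P] chain_frame_carrier b(1)]
          col_chain_frame[OF A(1) Wn b(1)] ..
      also have "\<dots> = minv c *\<^sub>v (P * A ^\<^sub>m ?d *\<^sub>v col W ?g)"
        using ci(1) P Ad cw by (simp add: assoc_mult_mat_vec[of _ n n _ n])
      also have "\<dots> = minv c *\<^sub>v (C.J ^\<^sub>m ?d *\<^sub>v (P *\<^sub>v col W ?g))"
        unfolding pow_mat_intertwine[OF A(1) C.J_carrier P PA] using P cw
        by (simp add: assoc_mult_mat_vec[of _ n n _ n])
      also have "\<dots> = minv c *\<^sub>v (C.J ^\<^sub>m ?d * c *\<^sub>v ?e)"
        unfolding Wc[OF b(2)] using c by (simp add: assoc_mult_mat_vec[of _ n n _ n])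
      also have "\<dots> = minv c *\<^sub>v (c *\<^sub>v (C.J ^\<^sub>m ?d *\<^sub>v ?e))"
        unfolding pow_mat_intertwine[OF C.J_carrier C.J_carrier c(1) c(3), symmetric] using c
        by (simp add: assoc_mult_mat_vec[of _ n n _ n])
      also have "\<dots> = C.J ^\<^sub>m ?d *\<^sub>v ?e"
      proof -
        have "C.J ^\<^sub>m ?d *\<^sub>v ?e \<in> carrier_vec n" by (rule mult_mat_vec_carrier[of _ n n]) auto
        then show ?thesis
          using assoc_mult_mat_vec[OF ci(1) c(1), symmetric] ci(2)[OF c(2)] by simp
      qed
      also have "\<dots> = unit_vec n (target b)"
      proof -
        have "\<tau> (N.blk b) < mC" "szC (\<tau> (N.blk b)) = h" "2 \<le> h" "?d < h"
          using \<tau>_top[of "N.blk b"] b h_ge_2[OF b(2)] szN_le[of "N.blk b"] by (auto simp: big_def depth_def)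
        then show ?thesis unfolding apex_def target_def by (subst C.J_pow_unit) auto
      qed
      finally show ?thesis .
    qed
    let ?z = "C.idx z 0"
    let ?F = "multrow_mat n ?z (-1) :: real mat"
    have zn: "?z < n" "C.blk ?z = z" using C.idx[of z 0] zero_block by auto
    have target_z: "target b \<noteq> ?z" if "b < n" "N.blk b \<in> big" for b
      using target[OF that] zn zero_block \<tau>_top[of "N.blk b"] h_ge_2[OF that(2)] that(2)
      by (auto simp: big_def)
    have FM: "?F * M = multrow ?z (-1) M" by (rule multrow_mat[OF M, symmetric])
    define M' where "M' = (if det M > 0 then M else ?F * M)"
    have M': "M' \<in> carrier_mat n n" using M by (auto simp: M'_def)
    have dM': "det M' > 0"
      using dM det_multrow[OF zn(1) M, of "-1"] by (auto simp: M'_def FM)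
    have "?F * M * X = ?F * (C.J * M)"
      using MX M X by (simp add: assoc_mult_mat[of _ n n _ n _ n])
    also have "\<dots> = ?F * C.J * M" using M by (simp add: assoc_mult_mat[of _ n n _ n _ n])
    also have "\<dots> = C.J * (?F * M)"
      unfolding C.flip_zero_block[OF zero_block] using M by (simp add: assoc_mult_mat[of _ n n _ n _ n])
    finally have "M' * X = C.J * M'" using MX by (simp add: M'_def)
    then have "X = minv M' * C.J * M'"
      using eq_minv_conjI[OF M' _ X C.J_carrier] dM' by simp
    moreover have "col M' b = unit_vec n (target b)" if "b < n" "N.blk b \<in> big" for b
    proof -
      have "col (multrow ?z (-1) M) b = unit_vec n (target b)"
      proof (rule eq_vecI)
        fix i assume "i < dim_vec (unit_vec n (target b) :: real vec)"
        then have i: "i < n" by simp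
        have "M $$ (i, b) = vec_index (unit_vec n (target b)) i"
          using arg_cong[OF colM[OF that], of "\<lambda>v. vec_index v i"] M i that by simp
        then show "vec_index (col (multrow ?z (-1) M) b) i = vec_index (unit_vec n (target b)) i"
          using M i that target_z[OF that] target(1)[OF that] by auto
      qed (use M in simp)
      then show ?thesis using colM[OF that] by (auto simp: M'_def FM)
    qed
    ultimately show "\<exists>M \<in> carrier_mat n n. det M > 0 \<and>
       (\<forall>b<n. N.blk b \<in> big \<longrightarrow> col M b = unit_vec n (target b)) \<and>
       minv ?G * A * ?G = minv M * C.J * M"
      using M' dM' unfolding X_def by blast
  qed
qed

text \<open>The prescribed columns of \<open>M\<close> are linked by \<open>C.J\<close> exactly as the basis vectors are linked by
  \<open>N.J\<close>, so the conjugate can differ from \<open>N.J\<close> only on the kernel of \<open>N.J\<close>, which is spanned by the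
  vectors at position 0.\<close>

lemma frame_conj_col:
  assumes M: "M \<in> carrier_mat n n" "det M \<noteq> 0"
    and cols: "\<forall>b<n. N.blk b \<in> big \<longrightarrow> col M b = unit_vec n (target b)"
    and b: "b < n" "0 < N.pos b"
  shows "col (minv M * C.J * M) b = col N.J b"
proof -
  note Mi = minv[OF M(1)] and r = N.loc_range[OF b(1)]
  have big: "N.blk b \<in> big" using r b by (auto simp: big_def)
  let ?b = "N.idx (N.blk b) (N.pos b - 1)"
  have b': "?b < n" "N.blk ?b = N.blk b" "N.pos ?b = N.pos b - 1"
    using N.idx[of "N.blk b" "N.pos b - 1"] r by auto
  have "depth ?b = Suc (depth b)" using b' r b by (simp add: depth_def)
  moreover have "szN (N.blk b) \<le> h" by (rule szN_le[OF r(1)])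
  then have "depth b < h - 1" using r b by (simp add: depth_def)
  ultimately have J: "C.J *\<^sub>v unit_vec n (target b) = unit_vec n (target ?b)"
    unfolding target_def b' using \<tau>_top[of "N.blk b"] big by (subst C.J_unit) (auto simp: big_def)
  have "col (minv M * C.J * M) b = minv M * C.J *\<^sub>v col M b"
    by (rule col_mult2) (use Mi M b in auto)
  also have "\<dots> = minv M *\<^sub>v (C.J *\<^sub>v col M b)"
    by (rule assoc_mult_mat_vec) (use Mi M b in auto)
  also have "C.J *\<^sub>v col M b = col M ?b"
    using cols J b b' big by simp
  also have "\<dots> = M *\<^sub>v unit_vec n ?b"
    using mult_mat_unit_vec[OF M(1) b'(1)] by simp
  also have "minv M *\<^sub>v (M *\<^sub>v unit_vec n ?b) = unit_vec n ?b"
    using Mi M by (simp flip: assoc_mult_mat_vec[of _ n n _ n])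
  finally show ?thesis using N.col_J[OF b(1)] b by simp
qed

text \<open>Conjugation by a diagonal matrix followed by scaling. The weights are the positions, so that
  \<open>N.J\<close> is fixed while every entry in a column at position 0 acquires a factor \<open>t\<close> to a positive
  power.\<close>

definition contract :: "real \<Rightarrow> real mat \<Rightarrow> real mat" where
  "contract t B = mat n n (\<lambda>(a, b). t * (t ^ N.pos a * B $$ (a, b) / t ^ N.pos b))"

lemma contract_carrier [simp]: "contract t B \<in> carrier_mat n n"
  by (simp add: contract_def)

lemma contract_1: "B \<in> carrier_mat n n \<Longrightarrow> contract 1 B = B"
  by (auto simp: contract_def intro!: eq_matI)

lemma contract_similar:
  assumes B: "B \<in> carrier_mat n n" "similar_mat B C.J" and t: "t > 0"
  shows "similar_mat (contract t B) C.J"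
proof -
  let ?D = "mat n n (\<lambda>(a, b). t ^ N.pos a * (t \<cdot>\<^sub>m B) $$ (a, b) / t ^ N.pos b)"
  have "contract t B = ?D"
    using B by (auto simp: contract_def intro!: eq_matI)
  moreover have "similar_mat ?D (t \<cdot>\<^sub>m B)"
    using diagonal_rescaling_similar[of "t \<cdot>\<^sub>m B" n "\<lambda>a. t ^ N.pos a"] B t by simp
  moreover have "similar_mat (t \<cdot>\<^sub>m B) (t \<cdot>\<^sub>m C.J)"
    using B(2) similar_mat_wit_smult unfolding similar_mat_def by blast
  moreover have "similar_mat (t \<cdot>\<^sub>m C.J) C.J" by (rule C.smult_J_similar) (use t in simp)
  ultimately show ?thesis using similar_mat_trans by metis
qed

lemma contract_close:
  assumes B: "B \<in> carrier_mat n n" and cols: "\<And>b. b < n \<Longrightarrow> 0 < N.pos b \<Longrightarrow> col B b = col N.J b"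
    and t: "0 < t" "t \<le> 1" and ij: "i < n" "j < n"
  shows "\<bar>contract t B $$ (i, j) - N.J $$ (i, j)\<bar> \<le> t * \<bar>B $$ (i, j) - N.J $$ (i, j)\<bar>"
proof (cases "N.pos j = 0")
  case True
  then have z: "N.J $$ (i, j) = 0" using ij by (simp add: N.J_def)
  have "t ^ N.pos i * \<bar>B $$ (i, j)\<bar> \<le> \<bar>B $$ (i, j)\<bar>"
    using t by (intro mult_left_le_one_le power_le_one) auto
  then show ?thesis using t ij True by (simp add: contract_def z abs_mult)
next
  case False
  have "B $$ (i, j) = N.J $$ (i, j)"
    using arg_cong[OF cols[OF ij(2)], of "\<lambda>v. vec_index v i"] False B ij by simp
  then show ?thesis using t ij by (auto simp: contract_def N.J_def)
qed


text \<open>The frames of normal forms are joined by a path of frames. The induced path in the class may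
  leave every neighbourhood of \<open>N.J\<close>, but it is bounded, so contracting all of it by a
  small \<open>T\<close> brings it back.\<close>

lemma frames_connected:
  assumes M: "M \<in> carrier_mat n n" "det M > 0"
      "\<forall>b<n. N.blk b \<in> big \<longrightarrow> col M b = unit_vec n (target b)"
    and M': "M' \<in> carrier_mat n n" "det M' > 0"
      "\<forall>b<n. N.blk b \<in> big \<longrightarrow> col M' b = unit_vec n (target b)"
    and \<epsilon>: "\<epsilon> > 0"
  obtains T where "0 < T" "T \<le> 1"
    "mpath n (conj_class C.J \<inter> mat_nbhd n \<epsilon> N.J)
       (contract T (minv M * C.J * M)) (contract T (minv M' * C.J * M'))"
proof -
  let ?Y = "{b. b < n \<and> N.blk b \<notin> big}" and ?I = "top_of_set {0..1::real}"
  have "M \<in> pos_frames n ?Y M'"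
  proof -
    have "M $$ (i, j) = M' $$ (i, j)" if "i < n" "j < n" "j \<notin> ?Y" for i j
      using M(1,3) M'(1,3) that by (metis (mono_tags, lifting) carrier_matD index_col mem_Collect_eq)
    then show ?thesis using M by (simp add: pos_frames_def)
  qed
  then have "mpath n (pos_frames n ?Y M') M M'"
    using M' by (intro pos_frames_path_connected) auto
  then obtain \<gamma> :: "real \<Rightarrow> real mat" where \<gamma>: "continuous_map ?I (mat_topology n) \<gamma>"
    and frames: "\<And>t. 0 \<le> t \<Longrightarrow> t \<le> 1 \<Longrightarrow> \<gamma> t \<in> pos_frames n ?Y M'" and ends: "\<gamma> 0 = M" "\<gamma> 1 = M'"
    by (rule mpathE) blast
  define B where "B t = minv (\<gamma> t) * C.J * \<gamma> t" for t
  have g: "\<gamma> t \<in> carrier_mat n n" "det (\<gamma> t) \<noteq> 0"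
    "\<forall>b<n. N.blk b \<in> big \<longrightarrow> col (\<gamma> t) b = unit_vec n (target b)" if t: "0 \<le> t" "t \<le> 1" for t
  proof -
    note f = frames[OF t, unfolded pos_frames_def mem_Collect_eq]
    show "\<gamma> t \<in> carrier_mat n n" "det (\<gamma> t) \<noteq> 0" using f by auto
    have "col (\<gamma> t) b = col M' b" if "b < n" "N.blk b \<in> big" for b
      using f M'(1) that by (intro eq_vecI) auto
    then show "\<forall>b<n. N.blk b \<in> big \<longrightarrow> col (\<gamma> t) b = unit_vec n (target b)"
      using M'(3) by simp
  qed
  have Bc: "B t \<in> carrier_mat n n" "similar_mat (B t) C.J"
    "\<And>b. b < n \<Longrightarrow> 0 < N.pos b \<Longrightarrow> col (B t) b = col N.J b" if t: "0 \<le> t" "t \<le> 1" for t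
  proof -
    show "B t \<in> carrier_mat n n"
      unfolding B_def by (intro mult_carrier_mat[of _ n n] minv(1) g(1) t C.J_carrier)
    show "similar_mat (B t) C.J"
      unfolding B_def by (rule minv_conj_similar[OF g(1,2)[OF t] C.J_carrier])
    fix b assume "b < n" "0 < N.pos b"
    then show "col (B t) b = col N.J b"
      unfolding B_def by (rule frame_conj_col[OF g[OF t]])
  qed
  have cB: "continuous_map ?I (mat_topology n) B"
    unfolding B_def by (intro continuous_map_mat_mult continuous_map_minv \<gamma>) (use g in auto)
  have entry: "continuous_on {0..1} (\<lambda>t. B t $$ (i, j))" if "i < n" "j < n" for i j
    using continuous_map_matD(2)[OF cB that] by simp
  \<comment> \<open>a continuous bound for all entries at once\<close>
  define f where "f t = (\<Sum>i<n. \<Sum>j<n. \<bar>B t $$ (i, j) - N.J $$ (i, j)\<bar>)" for t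
  have "continuous_on {0..1} f"
    unfolding f_def by (intro continuous_on_sum continuous_on_rabs continuous_on_diff entry continuous_on_const) auto
  then obtain K where K: "\<And>t. 0 \<le> t \<Longrightarrow> t \<le> 1 \<Longrightarrow> f t \<le> K"
    using continuous_attains_sup[of "{0..1::real}" f] by (metis atLeastAtMost_iff compact_Icc empty_iff order_refl zero_le_one)
  have f0: "0 \<le> f t" for t
    unfolding f_def by (intro sum_nonneg) auto
  have K0: "0 \<le> K" using f0[of 0] K[of 0] by simp
  define T where "T = min 1 (\<epsilon> / (2 * (K + 1)))"
  have T: "0 < T" "T \<le> 1" using K0 \<epsilon> by (auto simp: T_def)
  have TK: "T * K < \<epsilon>"
  proof -
    have "T * K \<le> \<epsilon> / (2 * (K + 1)) * K" using K0 by (intro mult_right_mono) (auto simp: T_def)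
    also have "\<dots> < \<epsilon>" using K0 \<epsilon> by (simp add: field_simps add_nonneg_pos)
    finally show ?thesis .
  qed
  have "contract T (B t) \<in> conj_class C.J \<inter> mat_nbhd n \<epsilon> N.J" if t: "0 \<le> t" "t \<le> 1" for t
  proof
    show "contract T (B t) \<in> conj_class C.J"
      using contract_similar[OF Bc(1,2)[OF t] T(1)] by (simp add: conj_class_def)
    have "\<bar>contract T (B t) $$ (i, j) - N.J $$ (i, j)\<bar> < \<epsilon>" if ij: "i < n" "j < n" for i j
    proof -
      have "\<bar>B t $$ (i, j) - N.J $$ (i, j)\<bar> \<le> (\<Sum>j<n. \<bar>B t $$ (i, j) - N.J $$ (i, j)\<bar>)"
        using ij by (intro member_le_sum) auto
      also have "\<dots> \<le> f t"
        unfolding f_def using ij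
        by (intro member_le_sum[where f = "\<lambda>i. \<Sum>j<n. \<bar>B t $$ (i, j) - N.J $$ (i, j)\<bar>"] sum_nonneg) auto
      also have "\<dots> \<le> K" by (rule K[OF t])
      finally have "T * \<bar>B t $$ (i, j) - N.J $$ (i, j)\<bar> \<le> T * K"
        using T by (intro mult_left_mono) auto
      then show ?thesis
        using contract_close[OF Bc(1,3)[OF t] T ij] TK by linarith
    qed
    then show "contract T (B t) \<in> mat_nbhd n \<epsilon> N.J"
      using \<epsilon> by (simp add: mat_nbhd_iff)
  qed
  moreover have "continuous_map ?I (mat_topology n) (\<lambda>t. contract T (B t))"
    unfolding continuous_map_mat_iff
    using T by (auto simp: contract_def intro!: continuous_intros entry)
  ultimately have "mpath n (conj_class C.J \<inter> mat_nbhd n \<epsilon> N.J) (contract T (B 0)) (contract T (B 1))"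
    by (intro mpathI[where \<gamma> = "\<lambda>t. contract T (B t)"]) auto
  then show thesis using that[OF T] by (simp add: B_def ends)
qed

lemma contract_path:
  assumes B: "B \<in> carrier_mat n n" "similar_mat B C.J" "B \<in> mat_nbhd n \<epsilon> N.J"
    and cols: "\<And>b. b < n \<Longrightarrow> 0 < N.pos b \<Longrightarrow> col B b = col N.J b" and T: "0 < T" "T \<le> 1"
  shows "mpath n (conj_class C.J \<inter> mat_nbhd n \<epsilon> N.J) B (contract T B)"
proof (rule mpathI[where \<gamma> = "\<lambda>t. contract ((1 - t) + t * T) B"])
  have s: "0 < (1 - t) + t * T \<and> (1 - t) + t * T \<le> 1" if t: "0 \<le> t" "t \<le> 1" for t :: real
  proof -
    have "t * (1 - T) \<le> 1 * (1 - T)" "0 \<le> t * (1 - T)"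
      using t T by (intro mult_right_mono, auto)
    then show ?thesis using T by (simp add: algebra_simps)
  qed
  have "(1 - t) + t * T \<noteq> 0" if "t \<in> {0..1}" for t
    using s[of t] that by auto
  then show "continuous_map (top_of_set {0..1}) (mat_topology n) (\<lambda>t. contract ((1 - t) + t * T) B)"
    unfolding continuous_map_mat_iff
    by (auto simp: contract_def intro!: continuous_intros)
  have close: "\<forall>i<n. \<forall>j<n. \<bar>B $$ (i, j) - N.J $$ (i, j)\<bar> < \<epsilon>" and \<epsilon>: "0 < \<epsilon>"
    using B(3) by (auto simp: mat_nbhd_iff)
  fix t :: real assume t: "0 \<le> t" "t \<le> 1"
  let ?s = "(1 - t) + t * T"
  have "\<bar>contract ?s B $$ (i, j) - N.J $$ (i, j)\<bar> < \<epsilon>" if ij: "i < n" "j < n" for i j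
  proof -
    have "\<bar>contract ?s B $$ (i, j) - N.J $$ (i, j)\<bar> \<le> ?s * \<bar>B $$ (i, j) - N.J $$ (i, j)\<bar>"
      using s[OF t] ij by (intro contract_close B cols) auto
    also have "\<dots> \<le> \<bar>B $$ (i, j) - N.J $$ (i, j)\<bar>"
      using s[OF t] by (intro mult_left_le_one_le) auto
    also have "\<dots> < \<epsilon>" using close ij by blast
    finally show ?thesis .
  qed
  moreover have "similar_mat (contract ?s B) C.J"
    using contract_similar[OF B(1,2)] s[OF t] by blast
  ultimately show "contract ?s B \<in> conj_class C.J \<inter> mat_nbhd n \<epsilon> N.J"
    using \<epsilon> by (simp add: mat_nbhd_iff conj_class_def)
qed (use contract_1 B in auto)

lemma conj_segment_path:
  assumes A: "A \<in> carrier_mat n n" "similar_mat A C.J"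
    and small: "\<And>G. G \<in> mat_nbhd n r (1\<^sub>m n) \<Longrightarrow> det G > 0 \<and> minv G * A * G \<in> mat_nbhd n \<epsilon> N.J"
    and G: "G \<in> mat_nbhd n r (1\<^sub>m n)"
  shows "mpath n (conj_class C.J \<inter> mat_nbhd n \<epsilon> N.J) A (minv G * A * G)"
proof -
  let ?s = "segment n (1\<^sub>m n) G"
  have Gc: "G \<in> carrier_mat n n" and r: "0 < r"
    and Gr: "\<forall>i<n. \<forall>j<n. \<bar>G $$ (i, j) - 1\<^sub>m n $$ (i, j)\<bar> < r"
    using mat_nbhd_iff[of "1\<^sub>m n" n G r] G by auto
  have s: "?s t \<in> mat_nbhd n r (1\<^sub>m n)" if t: "0 \<le> t" "t \<le> 1" for t
  proof -
    have "\<bar>?s t $$ (i, j) - 1\<^sub>m n $$ (i, j)\<bar> < r" if ij: "i < n" "j < n" for i j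
    proof -
      have "?s t $$ (i, j) - 1\<^sub>m n $$ (i, j) = t * (G $$ (i, j) - 1\<^sub>m n $$ (i, j))"
        using ij by (simp add: segment_def algebra_simps)
      then have "\<bar>?s t $$ (i, j) - 1\<^sub>m n $$ (i, j)\<bar> \<le> \<bar>G $$ (i, j) - 1\<^sub>m n $$ (i, j)\<bar>"
        using t by (simp only: abs_mult) (intro mult_left_le_one_le, auto)
      also have "\<dots> < r" using Gr ij by blast
      finally show ?thesis .
    qed
    then show ?thesis using mat_nbhd_iff[of "1\<^sub>m n" n "?s t" r] r by simp
  qed
  have ne: "det (?s t) \<noteq> 0" if "0 \<le> t" "t \<le> 1" for t
    using small[OF s[OF that]] by simp
  show ?thesis
  proof (rule mpathI[where \<gamma> = "\<lambda>t. minv (?s t) * A * ?s t"])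
    show "continuous_map (top_of_set {0..1}) (mat_topology n) (\<lambda>t. minv (?s t) * A * ?s t)"
      by (intro continuous_map_mat_mult continuous_map_minv continuous_map_segment continuous_map_mat_const A(1))
        (use ne in auto)
    fix t :: real assume t: "0 \<le> t" "t \<le> 1"
    have "similar_mat (minv (?s t) * A * ?s t) C.J"
      using similar_mat_trans[OF minv_conj_similar[OF _ ne[OF t] A(1)] A(2)] by simp
    then show "minv (?s t) * A * ?s t \<in> conj_class C.J \<inter> mat_nbhd n \<epsilon> N.J"
      using small[OF s[OF t]] by (simp add: conj_class_def)
  next
    have "minv (1\<^sub>m n) = 1\<^sub>m n" using minv[of "1\<^sub>m n" n] by simp
    then show "minv (?s 0) * A * ?s 0 = A" "minv (?s 1) * A * ?s 1 = minv G * A * G"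
      using Gc A by (simp_all add: segment_endpoints)
  qed
qed

lemma jordan_form_locally_connected: "class_locally_connected_at n (conj_class C.J) N.J"
  unfolding class_locally_connected_at_def
proof (intro allI impI)
  fix \<epsilon> :: real assume \<epsilon>: "\<epsilon> > 0"
  let ?S = "conj_class C.J \<inter> mat_nbhd n \<epsilon> N.J"
  obtain r where r: "r > 0" and small: "\<And>A G. A \<in> mat_nbhd n r N.J \<Longrightarrow> G \<in> mat_nbhd n r (1\<^sub>m n) \<Longrightarrow>
       det G > 0 \<and> minv G * A * G \<in> mat_nbhd n \<epsilon> N.J"
    using small_conjugation[OF N.J_carrier \<epsilon>] by blast
  obtain \<rho> where \<rho>: "\<rho> > 0" and near: "\<And>A W. A \<in> mat_nbhd n \<rho> N.J \<Longrightarrow> W \<in> mat_nbhd n \<rho> (1\<^sub>m n) \<Longrightarrow>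
    chain_frame A W \<in> mat_nbhd n r (1\<^sub>m n)"
    using chain_frame_near[OF r] by blast
  have reach: "\<exists>M \<in> carrier_mat n n. det M > 0 \<and>
       (\<forall>b<n. N.blk b \<in> big \<longrightarrow> col M b = unit_vec n (target b)) \<and>
       mpath n ?S A (minv M * C.J * M)"
    if A: "A \<in> conj_class C.J \<inter> mat_nbhd n (min r \<rho>) N.J" for A
  proof -
    have Ac: "A \<in> carrier_mat n n" "similar_mat A C.J" and Ar: "A \<in> mat_nbhd n r N.J" "A \<in> mat_nbhd n \<rho> N.J"
      using A by (auto simp: conj_class_def mat_nbhd_def)
    obtain W where W: "W \<in> mat_nbhd n \<rho> (1\<^sub>m n)" and nf: "det (chain_frame A W) \<noteq> 0 \<Longrightarrow>
       \<exists>M \<in> carrier_mat n n. det M > 0 \<and>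
       (\<forall>b<n. N.blk b \<in> big \<longrightarrow> col M b = unit_vec n (target b)) \<and>
       minv (chain_frame A W) * A * chain_frame A W = minv M * C.J * M"
      using normal_form[OF Ac \<rho>] by blast
    note G = near[OF Ar(2) W]
    have "mpath n ?S A (minv (chain_frame A W) * A * chain_frame A W)"
      by (rule conj_segment_path[OF Ac small[OF Ar(1)] G])
    moreover have "det (chain_frame A W) \<noteq> 0" using small[OF Ar(1) G] by simp
    ultimately show ?thesis using nf by metis
  qed
  have "mpath n ?S A A'" if A: "A \<in> conj_class C.J \<inter> mat_nbhd n (min r \<rho>) N.J"
    and A': "A' \<in> conj_class C.J \<inter> mat_nbhd n (min r \<rho>) N.J" for A A'
  proof -
    obtain M where M: "M \<in> carrier_mat n n" "det M > 0"
      "\<forall>b<n. N.blk b \<in> big \<longrightarrow> col M b = unit_vec n (target b)" "mpath n ?S A (minv M * C.J * M)"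
      using reach[OF A] by blast
    obtain M' where M': "M' \<in> carrier_mat n n" "det M' > 0"
      "\<forall>b<n. N.blk b \<in> big \<longrightarrow> col M' b = unit_vec n (target b)" "mpath n ?S A' (minv M' * C.J * M')"
      using reach[OF A'] by blast
    obtain T where T: "0 < T" "T \<le> 1"
      and mid: "mpath n ?S (contract T (minv M * C.J * M)) (contract T (minv M' * C.J * M'))"
      using frames_connected[OF M(1-3) M'(1-3) \<epsilon>] by blast
    have down: "mpath n ?S (minv X * C.J * X) (contract T (minv X * C.J * X))"
      if X: "X \<in> carrier_mat n n" "det X > 0"
        "\<forall>b<n. N.blk b \<in> big \<longrightarrow> col X b = unit_vec n (target b)"
        and p: "mpath n ?S D (minv X * C.J * X)" for X D
    proof (rule contract_path)
      have d: "det X \<noteq> 0" using X(2) by simp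
      show "similar_mat (minv X * C.J * X) C.J"
        by (rule minv_conj_similar[OF X(1) d C.J_carrier])
      show nb: "minv X * C.J * X \<in> mat_nbhd n \<epsilon> N.J"
        using mpath_endpoints(2)[OF p] by simp
      then show "minv X * C.J * X \<in> carrier_mat n n" by (simp add: mat_nbhd_def)
      show "col (minv X * C.J * X) b = col N.J b" if "b < n" "0 < N.pos b" for b
        by (rule frame_conj_col[OF X(1) d X(3) that])
    qed (fact T)+
    show ?thesis
      by (rule path_component_of_trans[OF M(4)], rule path_component_of_trans[OF down[OF M]],
          rule path_component_of_trans[OF mid], rule path_component_of_sym,
          rule path_component_of_trans[OF M'(4)], rule down[OF M'])
  qed
  then show "\<exists>\<delta>>0. \<forall>A\<in>conj_class C.J \<inter> mat_nbhd n \<delta> N.J. \<forall>B\<in>conj_class C.J \<inter> mat_nbhd n \<delta> N.J.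
      mpath n ?S A B"
    using r \<rho> by (intro exI[of _ "min r \<rho>"] conjI ballI) (simp, assumption)
qed

end

section \<open>Arbitrary nilpotent matrices\<close>

lemma jordan_nf_size:
  assumes "A \<in> carrier_mat n n" "jordan_nf A bs"
  shows "n = sum_list (map fst bs)"
proof -
  obtain m P Q where "{A, jordan_matrix bs, P, Q} \<subseteq> carrier_mat m m"
    using similar_matD assms(2) unfolding jordan_nf_def by blast
  then show ?thesis using assms(1) carrier_matD(1)[of "jordan_matrix bs" m m] by auto
qed

theorem theoremD2:
  fixes n :: nat and N :: "real mat" and \<C> :: "real mat set"
  assumes "N \<in> carrier_mat n n"
    and "nilpotent_mat N"
    and "nilpotent_class n \<C>"
    and "has_zero_block_class \<C>"
    and "h_class \<C> \<ge> h_mat N"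
    and "beta_top_class \<C> \<ge> beta_mat N"
  shows "class_locally_connected_at n \<C> N"
proof -
  obtain A where A: "A \<in> carrier_mat n n" "nilpotent_mat A" "\<C> = conj_class A"
    using assms(3) by (auto simp: nilpotent_class_def)
  obtain as where as: "jordan_nf A as" using nilpotent_mat_has_jordan_nf[OF A(1,2)] by blast
  obtain bs where bs: "jordan_nf N bs" using nilpotent_mat_has_jordan_nf[OF assms(1,2)] by blast
  have "mset (class_blocks \<C>) = mset as"
    unfolding A(3) by (rule class_blocks_mset[OF _ as]) (use similar_mat_refl[OF A(1)] in \<open>simp add: conj_class_def\<close>)
  note eqC = jordan_blocks_eqI[OF this]
  have "mset (class_blocks (conj_class N)) = mset bs"
    by (rule class_blocks_mset[OF _ bs]) (use similar_mat_refl[OF assms(1)] in \<open>simp add: conj_class_def\<close>)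
  note eqN = jordan_blocks_eqI[OF this]
  let ?h = "blocks_h as"
  have zero: "(1, 0) \<in> set as"
    using assms(4) eqC(4) by (simp add: has_zero_block_class_def blocks_zero_block_def)
  have h: "blocks_h bs \<le> ?h"
    using assms(5) eqC(1) eqN(1) by (simp add: h_mat_def h_class_def)
  have beta: "blocks_beta bs \<le> blocks_beta_top as"
    using assms(6) eqC(3) eqN(2) by (simp add: beta_mat_def beta_class_def beta_top_class_def)
  note evA = nilpotent_jordan_nf_eigenvalues[OF A(1,2) as]
  note evN = nilpotent_jordan_nf_eigenvalues[OF assms(1,2) bs]
  note JA = jordan_matrix_eq_J[OF evA jordan_nf_size[OF A(1) as]]
  note JN = jordan_matrix_eq_J[OF evN jordan_nf_size[OF assms(1) bs]]
  have le: "fst (xs ! i) \<le> blocks_h xs" if "i < length xs" for xs i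
    using that by (auto simp: blocks_h_def)
  let ?big = "{i. i < length bs \<and> 2 \<le> fst (bs ! i)}"
    and ?top = "{j. j < length as \<and> fst (as ! j) = ?h}"
  have "card ?big = blocks_beta bs"
    by (simp add: blocks_beta_def length_filter_conv_card case_prod_beta)
  moreover have "card ?top = blocks_beta_top as"
    by (simp add: blocks_beta_top_def length_filter_conv_card case_prod_beta)
  ultimately have "card ?big \<le> card ?top" using beta by simp
  then obtain \<tau> where \<tau>: "\<tau> ` ?big \<subseteq> ?top" "inj_on \<tau> ?big"
    using card_le_inj[of ?big ?top] by auto
  obtain z where z: "z < length as" "as ! z = (1, 0)"
    using zero by (auto simp: in_set_conv_nth)
  interpret jordan_pair n "length bs" "\<lambda>i. fst (bs ! i)" "block_loc (map fst bs)"
    "length as" "\<lambda>i. fst (as ! i)" "block_loc (map fst as)" ?h \<tau> z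
  proof (rule jordan_pair.intro[OF JN(1) JA(1)], unfold_locales)
    show "fst (bs ! i) \<le> ?h" if "i < length bs" for i using le[OF that] h by simp
    show "fst (as ! i) \<le> ?h" if "i < length as" for i by (rule le[OF that])
    show "\<tau> i < length as \<and> fst (as ! \<tau> i) = ?h" if "i < length bs" "2 \<le> fst (bs ! i)" for i
      using \<tau>(1) that by blast
  qed (use \<tau> z in auto)
  have simA: "similar_mat A (jordan_matrix as)" and simN: "similar_mat N (jordan_matrix bs)"
    using as bs by (auto simp: jordan_nf_def)
  have "\<C> = conj_class (jordan_matrix as)"
    unfolding A(3) conj_class_def using simA similar_mat_trans similar_mat_sym by blast
  then have "class_locally_connected_at n \<C> (jordan_matrix bs)"
    using jordan_form_locally_connected unfolding JA(2)[symmetric] JN(2)[symmetric] by simp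
  then show ?thesis
    by (rule class_locally_connected_at_similar[OF _ simN assms(1)])
      (auto simp: A(3) conj_class_def intro: similar_mat_trans)
qed

end
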